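(* There exists an algorithm that takes as input integers $C,D\in\mathbb{N}$ and a one-tape Turing machine $M$ and, if $M$ runs in time $Cn+D$, returns a deterministic finite automaton that accepts exactly the set of input words accepted by $M$.
   Context: $\mathbb{N}=\{0,1,2,\dots\}$. Turing machines are deterministic with an accepting and a rejecting halting state; $M$ accepts an input if it halts in the accepting state. A one-tape Turing machine has a single both-way infinite read-write tape which also holds the input, and its head moves (left or right) at every step. A Turing machine $M$ runs in time $T(n)$ if for every $n$, $M$ makes at most $T(n)$ steps on every input of length $n$. *)

theory Defs
  imports Main "HOL-Library.Nat_Bijection"
begin

section \<open>Algorithms: partial recursive functions\<close>

datatype recf =
    Zero
  | Succ
  | Proj nat
  | Comp recf "recf list"
  | Prim recf recf
  | Mu recf

text \<open>Arities are not tracked syntactically. The value \<open>None\<close> stands for divergence, and also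
  for an argument list of the wrong length. The recursion variable of \<open>Prim\<close> and the search
  variable of \<open>Mu\<close> come first; \<open>Mu\<close> requires all values below the first zero to be defined.\<close>

fun rec_eval :: "recf \<Rightarrow> nat list \<Rightarrow> nat option" where
  "rec_eval Zero xs = Some 0"
| "rec_eval Succ xs = (case xs of [x] \<Rightarrow> Some (Suc x) | _ \<Rightarrow> None)"
| "rec_eval (Proj i) xs = (if i < length xs then Some (xs ! i) else None)"
| "rec_eval (Comp f gs) xs =
     (if \<exists>g\<in>set gs. rec_eval g xs = None then None
      else rec_eval f (map (\<lambda>g. the (rec_eval g xs)) gs))"
| "rec_eval (Prim f g) xs =
     (case xs of [] \<Rightarrow> None
      | n # ys \<Rightarrow>
          rec_nat (rec_eval f ys)
            (\<lambda>m r. case r of None \<Rightarrow> None | Some v \<Rightarrow> rec_eval g (m # v # ys)) n)"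
| "rec_eval (Mu f) xs =
     (if \<exists>n. rec_eval f (n # xs) = Some 0 \<and> (\<forall>m<n. rec_eval f (m # xs) \<noteq> None)
      then Some (LEAST n. rec_eval f (n # xs) = Some 0) else None)"

section \<open>One-tape Turing machines\<close>

datatype dir = L | R

text \<open>Machines are finite objects with states \<open>{..<num_states}\<close>, tape symbols
  \<open>{..<num_syms}\<close> and input symbols \<open>{..<num_inputs}\<close>. The values of the transition function
  at halting states are irrelevant.\<close>

record tm =
  num_states :: nat
  num_inputs :: nat
  num_syms :: nat
  blank :: nat
  start :: nat
  acc_state :: nat
  rej_state :: nat
  trans :: "nat \<Rightarrow> nat \<Rightarrow> nat \<times> nat \<times> dir"

definition halting :: "tm \<Rightarrow> nat \<Rightarrow> bool" where
  "halting M q \<longleftrightarrow> q = acc_state M \<or> q = rej_state M"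

definition wf_tm :: "tm \<Rightarrow> bool" where
  "wf_tm M \<longleftrightarrow>
     num_inputs M \<le> blank M \<and> blank M < num_syms M \<and>
     start M < num_states M \<and> acc_state M < num_states M \<and> rej_state M < num_states M \<and>
     acc_state M \<noteq> rej_state M \<and>
     (\<forall>q<num_states M. \<not> halting M q \<longrightarrow>
        (\<forall>a<num_syms M. \<exists>p b d. trans M q a = (p, b, d) \<and> p < num_states M \<and> b < num_syms M))"

text \<open>A configuration consists of the state, the tape contents and the head position.\<close>

type_synonym config = "nat \<times> (int \<Rightarrow> nat) \<times> int"

definition init_config :: "tm \<Rightarrow> nat list \<Rightarrow> config" where
  "init_config M w =
     (start M, (\<lambda>i. if 0 \<le> i \<and> i < int (length w) then w ! nat i else blank M), 0)"

fun tm_step :: "tm \<Rightarrow> config \<Rightarrow> config" where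
  "tm_step M (q, t, h) =
     (if halting M q then (q, t, h)
      else case trans M q (t h) of
             (p, b, d) \<Rightarrow> (p, t(h := b), case d of L \<Rightarrow> h - 1 | R \<Rightarrow> h + 1))"

definition state_after :: "tm \<Rightarrow> nat list \<Rightarrow> nat \<Rightarrow> nat" where
  "state_after M w k = fst ((tm_step M ^^ k) (init_config M w))"

definition tm_lang :: "tm \<Rightarrow> nat list set" where
  "tm_lang M = {w. set w \<subseteq> {..<num_inputs M} \<and> (\<exists>k. state_after M w k = acc_state M)}"

text \<open>Halting configurations are fixed points of \<^const>\<open>tm_step\<close>, so \<open>M\<close> makes at most
  \<open>k\<close> steps on \<open>w\<close> iff its state after \<open>k\<close> applications is halting.\<close>

definition runs_in_time :: "tm \<Rightarrow> (nat \<Rightarrow> nat) \<Rightarrow> bool" where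
  "runs_in_time M T \<longleftrightarrow>
     (\<forall>n w. set w \<subseteq> {..<num_inputs M} \<and> length w = n \<longrightarrow> halting M (state_after M w (T n)))"

section \<open>Deterministic finite automata\<close>

record dfa =
  dfa_states :: nat
  dfa_inputs :: nat
  dfa_start :: nat
  dfa_final :: "nat set"
  dfa_trans :: "nat \<Rightarrow> nat \<Rightarrow> nat"

definition wf_dfa :: "dfa \<Rightarrow> bool" where
  "wf_dfa A \<longleftrightarrow>
     dfa_start A < dfa_states A \<and> dfa_final A \<subseteq> {..<dfa_states A} \<and>
     (\<forall>q<dfa_states A. \<forall>a<dfa_inputs A. dfa_trans A q a < dfa_states A)"

definition dfa_lang :: "dfa \<Rightarrow> nat list set" where
  "dfa_lang A =
     {w. set w \<subseteq> {..<dfa_inputs A} \<and> foldl (dfa_trans A) (dfa_start A) w \<in> dfa_final A}"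

section \<open>Codes of machines and automata\<close>

text \<open>Only the finite tables of the transition functions enter the codes.\<close>

definition dir_code :: "dir \<Rightarrow> nat" where
  "dir_code d = (case d of L \<Rightarrow> 0 | R \<Rightarrow> 1)"

definition tm_code :: "tm \<Rightarrow> nat" where
  "tm_code M = list_encode
     [num_states M, num_inputs M, num_syms M, blank M, start M, acc_state M, rej_state M,
      list_encode (map (\<lambda>q. list_encode (map (\<lambda>a. case trans M q a of
          (p, b, d) \<Rightarrow> list_encode [p, b, dir_code d]) [0..<num_syms M])) [0..<num_states M])]"

definition dfa_code :: "dfa \<Rightarrow> nat" where
  "dfa_code A = list_encode
     [dfa_states A, dfa_inputs A, dfa_start A,
      list_encode (map (\<lambda>q. of_bool (q \<in> dfa_final A)) [0..<dfa_states A]),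
      list_encode (map (\<lambda>q. list_encode (map (dfa_trans A q) [0..<dfa_inputs A]))
        [0..<dfa_states A])]"

text \<open>The code of an automaton determines its language.\<close>

lemma dfa_code_lang:
  assumes wf: "wf_dfa A" "wf_dfa B" and eq: "dfa_code A = dfa_code B"
  shows "dfa_inputs A = dfa_inputs B" "dfa_lang A = dfa_lang B"
proof -
  have e: "dfa_states A = dfa_states B" "dfa_inputs A = dfa_inputs B" "dfa_start A = dfa_start B"
    and f: "\<And>q. q < dfa_states A \<Longrightarrow> q \<in> dfa_final A \<longleftrightarrow> q \<in> dfa_final B"
    and t: "\<And>q a. q < dfa_states A \<Longrightarrow> a < dfa_inputs A \<Longrightarrow> dfa_trans A q a = dfa_trans B q a"
    using eq by (auto simp: dfa_code_def list_encode_eq of_bool_eq_iff)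
  show "dfa_inputs A = dfa_inputs B" by (fact e)
  have "foldl (dfa_trans A) q w = foldl (dfa_trans B) q w \<and>
      foldl (dfa_trans A) q w < dfa_states A"
    if "set w \<subseteq> {..<dfa_inputs A}" "q < dfa_states A" for q w
    using that
  proof (induction w arbitrary: q)
    case (Cons a w)
    then have "dfa_trans A q a < dfa_states A" using wf by (auto simp: wf_dfa_def)
    from Cons.IH[OF _ this] Cons.prems show ?case by (auto simp: t)
  qed simp
  then show "dfa_lang A = dfa_lang B"
    using wf e f unfolding dfa_lang_def wf_dfa_def by auto
qed

end

theory Submission
  imports Defs "HOL-Library.Sublist"
begin

text \<open>If two runs have the same crossing sequence at borders behind nonempty prefixes \<open>x1\<close> of
  \<open>x1 @ z1\<close> and \<open>x2\<close> of \<open>x2 @ z2\<close>, then the run on \<open>x1 @ z2\<close> behaves like the first one to the left of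
  the border and like the second one to the right of it. In a run of linear time on a long word many
  crossing sequences are short, so two of them agree and the word can be shortened without changing
  the number of visits to a given cell (Hennie's argument). Hence the number of visits to any cell,
  and with it the length of every crossing sequence, has a bound that is computable from \<open>C\<close>, \<open>D\<close> and
  \<open>M\<close>. Prefixes that allow the same pairs of crossing sequence and final state have the same
  continuations in the language, which gives a computable bound \<open>N\<close> on the number of states of some
  automaton for it. Two automata with at most \<open>N\<close> states are equivalent if they agree on all words
  of length less than \<open>N\<^sup>2\<close>. The algorithm therefore searches for an automaton with at most \<open>N\<close>
  states that agrees with \<open>M\<close> on these words.\<close>

section \<open>Closure properties of total recursive functions\<close>

text \<open>Argument lists of other lengths are left free, so a function may be replaced by any
  other that agrees with it on lists of length \<open>n\<close>.\<close>

definition computable :: "nat \<Rightarrow> (nat list \<Rightarrow> nat) \<Rightarrow> bool" where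
  "computable n f \<longleftrightarrow> (\<exists>r. \<forall>xs. length xs = n \<longrightarrow> rec_eval r xs = Some (f xs))"

abbreviation decidable :: "nat \<Rightarrow> (nat list \<Rightarrow> bool) \<Rightarrow> bool" where
  "decidable n P \<equiv> computable n (\<lambda>xs. of_bool (P xs))"

named_theorems computable_intros

lemma computable_nth [computable_intros]:
  assumes "i < n"
  shows "computable n (\<lambda>xs. xs ! i)"
  unfolding computable_def using assms by (intro exI[of _ "Proj i"]) simp

section \<open>Composition and primitive recursion\<close>

lemma computable_compose:
  assumes "computable k g" "length hs = k" "\<forall>h\<in>set hs. computable n h"
  shows "computable n (\<lambda>xs. g (map (\<lambda>h. h xs) hs))"
proof -
  obtain r where r: "\<And>ys. length ys = k \<Longrightarrow> rec_eval r ys = Some (g ys)"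
    using assms(1) unfolding computable_def by blast
  have "\<forall>h\<in>set hs. \<exists>s. \<forall>xs. length xs = n \<longrightarrow> rec_eval s xs = Some (h xs)"
    using assms(3) unfolding computable_def .
  then obtain s where s: "\<And>h xs. h \<in> set hs \<Longrightarrow> length xs = n \<Longrightarrow> rec_eval (s h) xs = Some (h xs)"
    by (metis bchoice)
  have "rec_eval (Comp r (map s hs)) xs = Some (g (map (\<lambda>h. h xs) hs))" if "length xs = n" for xs
  proof -
    have "map (\<lambda>f. the (rec_eval f xs)) (map s hs) = map (\<lambda>h. h xs) hs"
      using s that by simp
    then show ?thesis using s that r assms(2) by (auto simp del: map_map)
  qed
  then show ?thesis unfolding computable_def by blast
qed

lemma computable_compose1:
  assumes "computable 1 (\<lambda>ys. g (ys ! 0))" "computable n a"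
  shows "computable n (\<lambda>xs. g (a xs))"
  using computable_compose[OF assms(1), of "[a]" n] assms(2) by simp

lemma computable_compose2:
  assumes "computable 2 (\<lambda>ys. g (ys ! 0) (ys ! 1))" "computable n a" "computable n b"
  shows "computable n (\<lambda>xs. g (a xs) (b xs))"
  using computable_compose[OF assms(1), of "[a, b]" n] assms(2-) by simp

lemma computable_Suc [computable_intros]:
  assumes "computable n a"
  shows "computable n (\<lambda>xs. Suc (a xs))"
proof (rule computable_compose1[OF _ assms])
  show "computable 1 (\<lambda>ys. Suc (ys ! 0))"
    unfolding computable_def
    by (intro exI[of _ Succ]) (auto simp: length_Suc_conv split: list.splits)
qed

lemma computable_const [computable_intros]: "computable n (\<lambda>_. c)"
proof (induction c)
  case 0
  show ?case unfolding computable_def by (intro exI[of _ Zero]) simp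
next
  case (Suc c)
  then show ?case by (rule computable_Suc)
qed

text \<open>The parameters of the recursion are kept in a list, so one proof serves every number of
  them. The numbered variants here and below restate such lemmas for curried functions.\<close>

lemma computable_rec_list:
  assumes a: "computable k a" and g: "computable (Suc (Suc k)) g" and x: "computable n x"
    and ps: "length ps = k" "\<forall>p\<in>set ps. computable n p"
  shows "computable n (\<lambda>xs. rec_nat (a (map (\<lambda>p. p xs) ps))
           (\<lambda>m v. g (m # v # map (\<lambda>p. p xs) ps)) (x xs))"
proof -
  obtain ra where ra: "\<And>ys. length ys = k \<Longrightarrow> rec_eval ra ys = Some (a ys)"
    using a unfolding computable_def by blast
  obtain rg where rg: "\<And>ys. length ys = Suc (Suc k) \<Longrightarrow> rec_eval rg ys = Some (g ys)"
    using g unfolding computable_def by blast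
  let ?f = "\<lambda>xs. rec_nat (a (tl xs)) (\<lambda>m v. g (m # v # tl xs)) (hd xs)"
  have *: "rec_eval (Prim ra rg) (m # ys) = Some (?f (m # ys))" if "length ys = k" for m ys
    using that by (induction m) (simp_all add: ra rg)
  have "rec_eval (Prim ra rg) xs = Some (?f xs)" if "length xs = Suc k" for xs
    using *[of "tl xs" "hd xs"] that by (cases xs) auto
  then have "computable (Suc k) ?f"
    unfolding computable_def by blast
  from computable_compose[OF this, of "x # ps" n] show ?thesis using x ps by simp
qed

lemma computable_rec0:
  assumes "computable 2 (\<lambda>ys. g (ys ! 0) (ys ! 1))" "computable n x"
  shows "computable n (\<lambda>xs. rec_nat a g (x xs))"
  using computable_rec_list[OF computable_const[of 0 a], of "\<lambda>ys. g (ys ! 0) (ys ! 1)" n x "[]"] assms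
  by (simp add: numeral_2_eq_2)

lemma computable_rec1:
  assumes "computable 1 (\<lambda>ys. a (ys ! 0))" "computable 3 (\<lambda>ys. g (ys ! 0) (ys ! 1) (ys ! 2))"
    "computable n x" "computable n p"
  shows "computable n (\<lambda>xs. rec_nat (a (p xs)) (\<lambda>m v. g m v (p xs)) (x xs))"
  using computable_rec_list[OF assms(1), of "\<lambda>ys. g (ys ! 0) (ys ! 1) (ys ! 2)" n x "[p]"] assms(2-) by (simp add: eval_nat_numeral)

section \<open>Arithmetic and propositional operations\<close>

lemma computable_add [computable_intros]:
  assumes "computable n a" "computable n b"
  shows "computable n (\<lambda>xs. a xs + b xs)"
proof -
  have "rec_nat y (\<lambda>_ v. Suc v) x = x + y" for x y :: nat by (induction x) auto
  then show ?thesis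
    using computable_rec1[of "\<lambda>y. y" "\<lambda>_ v _. Suc v" n a b] assms
    by (simp add: computable_intros)
qed

lemma computable_mult [computable_intros]:
  assumes "computable n a" "computable n b"
  shows "computable n (\<lambda>xs. a xs * b xs)"
proof -
  have "rec_nat 0 (\<lambda>_ v. v + y) x = x * y" for x y :: nat by (induction x) auto
  then show ?thesis
    using computable_rec1[of "\<lambda>_. 0" "\<lambda>_ v y. v + y" n a b] assms
    by (simp add: computable_intros)
qed

lemma computable_power [computable_intros]:
  assumes "computable n a" "computable n b"
  shows "computable n (\<lambda>xs. a xs ^ b xs)"
proof -
  have "rec_nat 1 (\<lambda>_ v. v * y) x = y ^ x" for x y :: nat by (induction x) auto
  then show ?thesis
    using computable_rec1[of "\<lambda>_. 1" "\<lambda>_ v y. v * y" n b a] assms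
    by (simp add: computable_intros)
qed

lemma computable_pred:
  assumes "computable n a"
  shows "computable n (\<lambda>xs. a xs - 1)"
proof -
  have "rec_nat 0 (\<lambda>m _. m) x = x - 1" for x :: nat by (induction x) auto
  then show ?thesis
    using computable_rec0[of "\<lambda>m _. m" n a 0] assms by (simp add: computable_intros)
qed

lemma computable_diff [computable_intros]:
  assumes "computable n a" "computable n b"
  shows "computable n (\<lambda>xs. a xs - b xs)"
proof -
  have "rec_nat y (\<lambda>_ v. v - 1) x = y - x" for x y :: nat by (induction x) auto
  then show ?thesis
    using computable_rec1[of "\<lambda>y. y" "\<lambda>_ v _. v - 1" n b a] assms
      computable_pred[OF computable_nth, of 1 3]
    by (simp add: computable_intros)
qed

lemma decidable_not [computable_intros]:
  assumes "decidable n P"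
  shows "decidable n (\<lambda>xs. \<not> P xs)"
  using computable_diff[OF computable_const[of n 1] assms]
  by (rule back_subst[of "computable n"]) auto

lemma decidable_conj [computable_intros]:
  assumes "decidable n P" "decidable n Q"
  shows "decidable n (\<lambda>xs. P xs \<and> Q xs)"
  using computable_mult[OF assms] by (rule back_subst[of "computable n"]) auto

lemma decidable_imp [computable_intros]:
  assumes "decidable n P" "decidable n Q"
  shows "decidable n (\<lambda>xs. P xs \<longrightarrow> Q xs)"
  using decidable_not[OF decidable_conj[OF assms(1) decidable_not[OF assms(2)]]]
  by (rule back_subst[of "computable n"]) auto

lemma decidable_iff [computable_intros]:
  assumes "decidable n P" "decidable n Q"
  shows "decidable n (\<lambda>xs. P xs \<longleftrightarrow> Q xs)"
  using decidable_conj[OF decidable_imp[OF assms] decidable_imp[OF assms(2,1)]]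
  by (rule back_subst[of "computable n"]) auto

text \<open>With truncated subtraction, \<open>1 - (1 - (b - a))\<close> is 1 if
  \<open>b - a\<close> is positive and 0 otherwise.\<close>

lemma decidable_less [computable_intros]:
  assumes "computable n a" "computable n b"
  shows "decidable n (\<lambda>xs. a xs < b xs)"
  using computable_diff[OF computable_const[of n 1]
      computable_diff[OF computable_const[of n 1] computable_diff[OF assms(2,1)]]]
  by (rule back_subst[of "computable n"]) auto

lemma decidable_le [computable_intros]:
  assumes "computable n a" "computable n b"
  shows "decidable n (\<lambda>xs. a xs \<le> b xs)"
  using decidable_not[OF decidable_less[OF assms(2,1)]]
  by (simp add: not_less)

lemma decidable_eq [computable_intros]:
  assumes "computable n a" "computable n b"
  shows "decidable n (\<lambda>xs. a xs = b xs)"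
  using decidable_conj[OF decidable_le[OF assms] decidable_le[OF assms(2,1)]]
  by (rule back_subst[of "computable n"]) auto

lemma computable_if [computable_intros]:
  assumes "decidable n P" "computable n a" "computable n b"
  shows "computable n (\<lambda>xs. if P xs then a xs else b xs)"
  using computable_add[OF computable_mult[OF assms(1,2)]
      computable_mult[OF decidable_not[OF assms(1)] assms(3)]]
  by (rule back_subst[of "computable n"]) auto

section \<open>Bounded sums, bounded quantifiers and iteration\<close>

lemma computable_sum_list:
  assumes g: "computable (Suc k) g" and x: "computable n x"
    and ps: "length ps = k" "\<forall>p\<in>set ps. computable n p"
  shows "computable n (\<lambda>xs. \<Sum>i<x xs. g (i # map (\<lambda>p. p xs) ps))"
proof -
  \<comment> \<open>A recursion step receives the index, the accumulated sum and the parameters,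
    whereas the summand takes no accumulator: position 1 is dropped.\<close>
  let ?g = "\<lambda>ys. g (ys ! 0 # drop 2 ys)"
  let ?hs = "(\<lambda>ys. ys ! 0) # map (\<lambda>i ys. ys ! i) [2..<Suc (Suc k)]"
  have "computable (Suc (Suc k)) (\<lambda>ys. g (map (\<lambda>h. h ys) ?hs))"
    by (rule computable_compose[OF g]) (auto simp: computable_nth)
  moreover have "g (map (\<lambda>h. h ys) ?hs) = ?g ys" if "length ys = Suc (Suc k)" for ys
    using that by (auto intro!: arg_cong[of _ _ g] nth_equalityI simp del: upt_Suc)
  ultimately have "computable (Suc (Suc k)) ?g"
    by (simp add: computable_def)
  then have "computable (Suc (Suc k)) (\<lambda>ys. ys ! 1 + ?g ys)"
    by (intro computable_add computable_nth) simp_all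
  from computable_rec_list[OF computable_const[of k 0] this x ps]
  have *: "computable n (\<lambda>xs. rec_nat 0 (\<lambda>m v. v + g (m # map (\<lambda>p. p xs) ps)) (x xs))"
    by simp
  have "rec_nat 0 (\<lambda>m v. v + h m) y = (\<Sum>i<y. h i)" for h :: "nat \<Rightarrow> nat" and y
    by (induction y) auto
  note this[of "\<lambda>m. g (m # map (\<lambda>p. p xs) ps)" "x xs" for xs]
  with * show ?thesis by simp
qed

lemma computable_sum0:
  assumes "computable 1 (\<lambda>ys. g (ys ! 0))" "computable n x"
  shows "computable n (\<lambda>xs. \<Sum>i<x xs. g i)"
  using computable_sum_list[of 0 "\<lambda>ys. g (ys ! 0)" n x "[]"] assms by simp

lemma computable_sum1:
  assumes "computable 2 (\<lambda>ys. g (ys ! 0) (ys ! 1))" "computable n x" "computable n p"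
  shows "computable n (\<lambda>xs. \<Sum>i<x xs. g i (p xs))"
  using computable_sum_list[of 1 "\<lambda>ys. g (ys ! 0) (ys ! 1)" n x "[p]"] assms by (simp add: eval_nat_numeral)

lemma computable_sum2:
  assumes "computable 3 (\<lambda>ys. g (ys ! 0) (ys ! 1) (ys ! 2))" "computable n x" "computable n p"
    "computable n q"
  shows "computable n (\<lambda>xs. \<Sum>i<x xs. g i (p xs) (q xs))"
  using computable_sum_list[of 2 "\<lambda>ys. g (ys ! 0) (ys ! 1) (ys ! 2)" n x "[p, q]"] assms by (simp add: eval_nat_numeral)

lemma computable_sum4:
  assumes "computable 5 (\<lambda>ys. g (ys ! 0) (ys ! 1) (ys ! 2) (ys ! 3) (ys ! 4))" "computable n x"
    "computable n p" "computable n q" "computable n r" "computable n s"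
  shows "computable n (\<lambda>xs. \<Sum>i<x xs. g i (p xs) (q xs) (r xs) (s xs))"
  using computable_sum_list[of 4 "\<lambda>ys. g (ys ! 0) (ys ! 1) (ys ! 2) (ys ! 3) (ys ! 4)"
      n x "[p, q, r, s]"] assms by (simp add: eval_nat_numeral)

text \<open>The counterexamples are counted by a bounded sum, and subtracting it from 1 tests it for
  zero. This reduces bounded quantifiers to bounded sums.\<close>

lemma of_bool_all_less: "of_bool (\<forall>i<b. P i) = (1 - (\<Sum>i<b. of_bool (\<not> P i)) :: nat)"
  for b :: nat
proof -
  have "(\<Sum>i<b. of_bool (\<not> P i) :: nat) = 0 \<longleftrightarrow> (\<forall>i<b. P i)"
    by (auto simp: sum_eq_0_iff simp del: sum_of_bool_eq)
  then show ?thesis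
    by (cases "\<Sum>i<b. of_bool (\<not> P i) :: nat") (simp_all del: sum_of_bool_eq)
qed

lemma decidable_all1:
  assumes "decidable 2 (\<lambda>ys. P (ys ! 0) (ys ! 1))" "computable n x" "computable n p"
  shows "decidable n (\<lambda>xs. \<forall>i<x xs. P i (p xs))"
  unfolding of_bool_all_less using assms
  by (intro computable_diff computable_const computable_sum1[of "\<lambda>i p. of_bool (\<not> P i p)"] decidable_not)

lemma decidable_all2:
  assumes "decidable 3 (\<lambda>ys. P (ys ! 0) (ys ! 1) (ys ! 2))" "computable n x" "computable n p"
    "computable n q"
  shows "decidable n (\<lambda>xs. \<forall>i<x xs. P i (p xs) (q xs))"
  unfolding of_bool_all_less using assms
  by (intro computable_diff computable_const computable_sum2[of "\<lambda>i p q. of_bool (\<not> P i p q)"] decidable_not)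

lemma decidable_all4:
  assumes "decidable 5 (\<lambda>ys. P (ys ! 0) (ys ! 1) (ys ! 2) (ys ! 3) (ys ! 4))" "computable n x"
    "computable n p" "computable n q" "computable n r" "computable n s"
  shows "decidable n (\<lambda>xs. \<forall>i<x xs. P i (p xs) (q xs) (r xs) (s xs))"
  unfolding of_bool_all_less using assms
  by (intro computable_diff computable_const
      computable_sum4[of "\<lambda>i p q r s. of_bool (\<not> P i p q r s)"] decidable_not)

lemma computable_funpow0:
  assumes "computable 1 (\<lambda>ys. g (ys ! 0))" "computable n x" "computable n a"
  shows "computable n (\<lambda>xs. (g ^^ x xs) (a xs))"
proof -
  have "rec_nat a (\<lambda>_ v. g v) m = (g ^^ m) a" for a m by (induction m) auto
  moreover have "computable 3 (\<lambda>ys. g (ys ! 1))"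
    using computable_compose1[OF assms(1) computable_nth[of 1 3]] by simp
  ultimately show ?thesis
    using computable_rec1[of "\<lambda>a. a" "\<lambda>_ v _. g v" n x a] assms by (simp add: computable_intros)
qed

lemma computable_funpow1:
  assumes "computable 2 (\<lambda>ys. g (ys ! 0) (ys ! 1))" "computable n x" "computable n p" "computable n a"
  shows "computable n (\<lambda>xs. (g (p xs) ^^ x xs) (a xs))"
proof -
  have "rec_nat a (\<lambda>_ v. g p v) m = (g p ^^ m) a" for a m p by (induction m) auto
  moreover have "computable 4 (\<lambda>ys. g (ys ! 2) (ys ! 1))"
    using computable_compose2[OF assms(1) computable_nth[of 2 4] computable_nth[of 1 4]] by simp
  ultimately show ?thesis
    using computable_rec_list[of 2 "\<lambda>ys. ys ! 1" "\<lambda>ys. g (ys ! 2) (ys ! 1)" n x "[p, a]"] assms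
    by (simp add: computable_intros)
qed

section \<open>Pairs and lists as numbers\<close>

lemma computable_prod_encode [computable_intros]:
  assumes "computable n a" "computable n b"
  shows "computable n (\<lambda>xs. prod_encode (a xs, b xs))"
proof -
  have t: "triangle m = (\<Sum>i<m. Suc i)" for m by (induction m) auto
  show ?thesis
    unfolding prod_encode_def t prod.case
    by (intro computable_intros computable_sum0 assms) simp
qed

text \<open>Both components of a pair are at most its code. Decoding therefore amounts to a bounded
  double sum with a single relevant term, whose form shows that the projections are
  computable.\<close>

lemma sum_prod_decode:
  "(\<Sum>x<Suc n. \<Sum>y<Suc n. if prod_encode (x, y) = n then f x y else 0)
     = (f (fst (prod_decode n)) (snd (prod_decode n)) :: nat)"
proof -
  obtain a b where ab: "prod_decode n = (a, b)" by fastforce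
  then have n: "n = prod_encode (a, b)" by (metis prod_decode_inverse)
  then have le: "a < Suc n" "b < Suc n"
    using le_prod_encode_1[of a b] le_prod_encode_2[of b a] by auto
  have "(\<Sum>x<Suc n. \<Sum>y<Suc n. if prod_encode (x, y) = n then f x y else 0)
      = (\<Sum>x<Suc n. \<Sum>y<Suc n. if y = b then if x = a then f x y else 0 else 0)"
    unfolding n prod_encode_eq by (intro sum.cong) auto
  also have "\<dots> = f a b" using le by (simp add: sum.delta del: sum.lessThan_Suc)
  finally show ?thesis using ab by simp
qed

lemma computable_fst_decode [computable_intros]:
  assumes "computable n a"
  shows "computable n (\<lambda>xs. fst (prod_decode (a xs)))"
  unfolding sum_prod_decode[where f = "\<lambda>x y. x", symmetric]
  by (intro computable_sum1[of "\<lambda>x m. \<Sum>y<Suc m. if prod_encode (x, y) = m then x else 0"]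
      computable_sum2[of "\<lambda>y x m. if prod_encode (x, y) = m then x else 0"] computable_intros assms)
    simp_all

lemma computable_snd_decode [computable_intros]:
  assumes "computable n a"
  shows "computable n (\<lambda>xs. snd (prod_decode (a xs)))"
  unfolding sum_prod_decode[where f = "\<lambda>x y. y", symmetric]
  by (intro computable_sum1[of "\<lambda>x m. \<Sum>y<Suc m. if prod_encode (x, y) = m then y else 0"]
      computable_sum2[of "\<lambda>y x m. if prod_encode (x, y) = m then y else 0"] computable_intros assms)
    simp_all

text \<open>A nonempty list has the code \<open>Suc (prod_encode (x, c))\<close> with head
  \<open>x\<close> and tail code \<open>c\<close>; the empty list has code 0.\<close>

definition hd_code :: "nat \<Rightarrow> nat" where
  "hd_code c = (if c = 0 then 0 else fst (prod_decode (c - 1)))"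

definition tl_code :: "nat \<Rightarrow> nat" where
  "tl_code c = (if c = 0 then 0 else snd (prod_decode (c - 1)))"

definition nth_code :: "nat \<Rightarrow> nat \<Rightarrow> nat" where
  "nth_code c i = hd_code ((tl_code ^^ i) c)"

text \<open>Counts the nonempty tails. Looking at the first \<open>c\<close> tails is enough because
  a list is no longer than its code.\<close>

definition length_code :: "nat \<Rightarrow> nat" where
  "length_code c = (\<Sum>i<c. of_bool ((tl_code ^^ i) c \<noteq> 0))"

lemma computable_hd_code [computable_intros]:
  "computable n a \<Longrightarrow> computable n (\<lambda>xs. hd_code (a xs))"
  unfolding hd_code_def by (intro computable_intros)

lemma computable_tl_code [computable_intros]:
  "computable n a \<Longrightarrow> computable n (\<lambda>xs. tl_code (a xs))"
  unfolding tl_code_def by (intro computable_intros)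

lemma computable_nth_code [computable_intros]:
  "computable n a \<Longrightarrow> computable n b \<Longrightarrow> computable n (\<lambda>xs. nth_code (a xs) (b xs))"
  unfolding nth_code_def by (intro computable_intros computable_funpow0) simp

lemma computable_length_code [computable_intros]:
  "computable n a \<Longrightarrow> computable n (\<lambda>xs. length_code (a xs))"
  unfolding length_code_def
  by (intro computable_intros computable_funpow0
      computable_sum1[of "\<lambda>i c. of_bool ((tl_code ^^ i) c \<noteq> 0)"]) simp_all

lemma hd_code_list_encode [simp]: "xs \<noteq> [] \<Longrightarrow> hd_code (list_encode xs) = hd xs"
  by (cases xs) (auto simp: hd_code_def)

lemma tl_code_list_encode [simp]: "tl_code (list_encode xs) = list_encode (tl xs)"
  by (cases xs) (auto simp: tl_code_def)

lemma list_encode_eq_0 [simp]: "list_encode xs = 0 \<longleftrightarrow> xs = []"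
  by (cases xs) auto

lemma funpow_tl_code [simp]: "(tl_code ^^ i) (list_encode xs) = list_encode (drop i xs)"
  by (induction i) (auto simp: drop_Suc tl_drop)

lemma nth_code_list_encode [simp]: "i < length xs \<Longrightarrow> nth_code (list_encode xs) i = xs ! i"
  by (simp add: nth_code_def hd_drop_conv_nth)

lemma length_le_list_encode: "length xs \<le> list_encode xs"
proof (induction xs)
  case (Cons x xs)
  then show ?case using le_prod_encode_2[of "list_encode xs" x] by simp
qed simp

lemma length_code_list_encode [simp]: "length_code (list_encode xs) = length xs"
proof -
  have "length_code (list_encode xs) = card ({..<list_encode xs} \<inter> {i. i < length xs})"
    unfolding length_code_def by (simp add: not_le)
  also have "{..<list_encode xs} \<inter> {i. i < length xs} = {..<length xs}"
    using length_le_list_encode[of xs] by auto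
  finally show ?thesis by simp
qed

section \<open>Finite automata and left quotients\<close>

definition left_quotient :: "nat list set \<Rightarrow> nat list \<Rightarrow> nat list set" where
  "left_quotient X x = {z. x @ z \<in> X}"

lemma foldl_dfa_less:
  assumes "wf_dfa A" "q < dfa_states A" "set w \<subseteq> {..<dfa_inputs A}"
  shows "foldl (dfa_trans A) q w < dfa_states A"
  using assms(2,3)
proof (induction w arbitrary: q)
  case (Cons a w)
  then show ?case using assms(1) by (simp add: wf_dfa_def)
qed simp

text \<open>Pumping in the product automaton: a word that is not shorter than the number of state
  pairs has more prefixes than there are pairs. Two prefixes reach the same pair, and removing the
  factor between them changes acceptance in neither automaton.\<close>

lemma dfa_lang_eqI:
  assumes wf: "wf_dfa A" "wf_dfa B" and inputs: "dfa_inputs A = dfa_inputs B"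
    and eq: "\<And>w. set w \<subseteq> {..<dfa_inputs A} \<Longrightarrow> length w < dfa_states A * dfa_states B \<Longrightarrow>
      w \<in> dfa_lang A \<longleftrightarrow> w \<in> dfa_lang B"
  shows "dfa_lang A = dfa_lang B"
proof -
  have "w \<in> dfa_lang A \<longleftrightarrow> w \<in> dfa_lang B" if "set w \<subseteq> {..<dfa_inputs A}" for w
    using that
  proof (induction "length w" arbitrary: w rule: less_induct)
    case less
    show ?case
    proof (cases "length w < dfa_states A * dfa_states B")
      case False
      let ?r = "\<lambda>A i. foldl (dfa_trans A) (dfa_start A) (take i w)"
      let ?f = "\<lambda>i. (?r A i, ?r B i)"
      have letters: "set (take i w) \<subseteq> {..<dfa_inputs A}" "set (drop i w) \<subseteq> {..<dfa_inputs A}" for i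
        using less.prems set_take_subset[of i w] set_drop_subset[of i w] by auto
      have "?f ` {..length w} \<subseteq> {..<dfa_states A} \<times> {..<dfa_states B}"
        using foldl_dfa_less[OF wf(1) _ letters(1)] foldl_dfa_less[OF wf(2) _ letters(1)[unfolded inputs]]
          wf inputs letters by (auto simp: wf_dfa_def image_subset_iff)
      then have "card (?f ` {..length w}) \<le> card ({..<dfa_states A} \<times> {..<dfa_states B})"
        by (intro card_mono) auto
      then have "\<not> inj_on ?f {..length w}"
        using False by (auto dest: card_image simp: card_cartesian_product)
      then obtain i j where "i \<le> length w" "j \<le> length w" "i \<noteq> j" "?f i = ?f j"
        by (auto simp: inj_on_def)
      then obtain i j where ij: "i < j" "j \<le> length w" "?f i = ?f j"
        by (metis linorder_neq_iff)
      let ?w = "take i w @ drop j w"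
      have "?w \<in> dfa_lang A \<longleftrightarrow> ?w \<in> dfa_lang B"
        using ij letters by (intro less.hyps) auto
      moreover have same: "?w \<in> dfa_lang X \<longleftrightarrow> take j w @ drop j w \<in> dfa_lang X"
        if "?r X i = ?r X j" "dfa_inputs X = dfa_inputs A" for X
        using that letters[of i] letters[of j]
        by (simp add: dfa_lang_def del: append_take_drop_id)
      ultimately show ?thesis using same[of A] same[of B] ij inputs by simp
    qed (use eq less.prems in blast)
  qed
  moreover have "dfa_lang A \<subseteq> {w. set w \<subseteq> {..<dfa_inputs A}}"
    "dfa_lang B \<subseteq> {w. set w \<subseteq> {..<dfa_inputs A}}"
    using inputs by (auto simp: dfa_lang_def)
  ultimately show ?thesis by blast
qed

lemma left_quotient_Cons: "left_quotient X (x @ [a]) = {z. a # z \<in> left_quotient X x}"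
  by (simp add: left_quotient_def)

text \<open>The Myhill-Nerode construction: the states number the left quotients, a letter takes a
  further quotient, and a quotient is final if it contains the empty word. The state count is kept
  because it bounds the search later.\<close>

lemma left_quotient_dfa:
  assumes X: "X \<subseteq> {w. set w \<subseteq> {..<k}}"
    and fin: "finite (left_quotient X ` {w. set w \<subseteq> {..<k}})"
  obtains A where "wf_dfa A" "dfa_inputs A = k" "dfa_lang A = X"
    "dfa_states A = card (left_quotient X ` {w. set w \<subseteq> {..<k}})"
proof -
  let ?W = "{w. set w \<subseteq> {..<k}}"
  let ?Q = "left_quotient X ` ?W"
  obtain h where h: "bij_betw h ?Q {0..<card ?Q}"
    using ex_bij_betw_finite_nat[OF fin] by blast
  define g where "g = inv_into ?Q h"
  have gh: "g (h Y) = Y" if "Y \<in> ?Q" for Y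
    using h that by (simp add: g_def bij_betw_inv_into_left)
  have hQ: "h Y < card ?Q" if "Y \<in> ?Q" for Y
    using h that by (auto simp: bij_betw_def)
  have gQ: "g q \<in> ?Q" if "q < card ?Q" for q
    using bij_betwE[OF bij_betw_inv_into[OF h]] that by (simp add: g_def)
  have step: "{z. a # z \<in> Y} \<in> ?Q" if Y: "Y \<in> ?Q" and a: "a < k" for Y a
  proof -
    obtain x where x: "x \<in> ?W" "Y = left_quotient X x" using Y by blast
    then have "{z. a # z \<in> Y} = left_quotient X (x @ [a])" "x @ [a] \<in> ?W"
      using a by (auto simp: left_quotient_Cons)
    then show ?thesis by blast
  qed
  define A where "A = \<lparr>dfa_states = card ?Q, dfa_inputs = k, dfa_start = h (left_quotient X []),
    dfa_final = {q. q < card ?Q \<and> [] \<in> g q}, dfa_trans = (\<lambda>q a. h {z. a # z \<in> g q})\<rparr>"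
  have nil: "left_quotient X [] \<in> ?Q" by (rule imageI) simp
  have run: "foldl (dfa_trans A) (h (left_quotient X [])) w = h (left_quotient X w)" if "w \<in> ?W" for w
    using that
  proof (induction w rule: rev_induct)
    case (snoc a w)
    then have "left_quotient X w \<in> ?Q" by auto
    then show ?case using snoc gh by (simp add: A_def left_quotient_Cons)
  qed simp
  have wf: "wf_dfa A"
    using hQ[OF nil] hQ[OF step[OF gQ]] by (auto simp: wf_dfa_def A_def)
  have "w \<in> dfa_lang A \<longleftrightarrow> w \<in> X" for w
  proof (cases "w \<in> ?W")
    case True
    then have "left_quotient X w \<in> ?Q" by blast
    then have "w \<in> dfa_lang A \<longleftrightarrow> [] \<in> left_quotient X w"
      using True run[OF True] gh hQ by (simp add: dfa_lang_def) (simp add: A_def)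
    then show ?thesis by (simp add: left_quotient_def)
  next
    case False
    then show ?thesis using X by (auto simp: dfa_lang_def A_def)
  qed
  then show ?thesis using that[of A] wf by (auto simp: A_def)
qed

section \<open>Crossing sequences\<close>

abbreviation tape :: "config \<Rightarrow> int \<Rightarrow> nat" where
  "tape c \<equiv> fst (snd c)"

abbreviation pos :: "config \<Rightarrow> int" where
  "pos c \<equiv> snd (snd c)"

context
  fixes M :: tm
begin

section \<open>Runs, crossings and visits\<close>

definition run :: "config \<Rightarrow> nat \<Rightarrow> config" where
  "run c k = (tm_step M ^^ k) c"

definition halted :: "config \<Rightarrow> nat \<Rightarrow> bool" where
  "halted c k \<longleftrightarrow> halting M (fst (run c k))"

text \<open>Each crossing contributes the state after the move. Directions need no record, since
  moves out of and into \<open>A\<close> alternate.\<close>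

primrec crossings :: "int set \<Rightarrow> config \<Rightarrow> nat \<Rightarrow> nat list" where
  "crossings A c 0 = []"
| "crossings A c (Suc k) = crossings A c k @
     (if pos (run c k) \<in> A \<longleftrightarrow> pos (run c (Suc k)) \<in> A then [] else [fst (run c (Suc k))])"

text \<open>Idle steps after halting do not count, so the number is constant from the halting time
  on.\<close>

primrec visits :: "int \<Rightarrow> config \<Rightarrow> nat \<Rightarrow> nat" where
  "visits j c 0 = 0"
| "visits j c (Suc k) = visits j c k + of_bool (pos (run c k) = j \<and> \<not> halted c k)"

lemma run_0 [simp]: "run c 0 = c"
  by (simp add: run_def)

lemma run_Suc: "run c (Suc k) = tm_step M (run c k)"
  by (simp add: run_def)

lemma run_Suc_halted: "halted c k \<Longrightarrow> run c (Suc k) = run c k"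
  unfolding halted_def run_Suc by (cases "run c k") simp

lemma run_Suc_cases:
  assumes "\<not> halted c k"
  obtains p b d where "trans M (fst (run c k)) (tape (run c k) (pos (run c k))) = (p, b, d)"
    "run c (Suc k) = (p, (tape (run c k))(pos (run c k) := b),
       case d of L \<Rightarrow> pos (run c k) - 1 | R \<Rightarrow> pos (run c k) + 1)"
proof -
  obtain q t h where r: "run c k = (q, t, h)" using prod_cases3 by blast
  obtain p b d where tr: "trans M q (t h) = (p, b, d)" using prod_cases3 by blast
  show ?thesis using that[of p b d] assms r tr by (cases d) (simp_all add: run_Suc halted_def)
qed

lemma tape_run_Suc: "j \<noteq> pos (run c k) \<Longrightarrow> tape (run c (Suc k)) j = tape (run c k) j"
  by (cases "halted c k") (auto simp: run_Suc_halted elim: run_Suc_cases)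

lemma pos_run_Suc: "\<not> halted c k \<Longrightarrow> \<bar>pos (run c k) - pos (run c (Suc k))\<bar> = 1"
  by (erule run_Suc_cases) (auto split: dir.splits)

lemma halted_mono:
  assumes "halted c k" "k \<le> m"
  shows "run c m = run c k" "halted c m" "crossings A c m = crossings A c k"
    "visits j c m = visits j c k"
proof -
  have "run c m = run c k \<and> halted c m \<and> crossings A c m = crossings A c k \<and>
      visits j c m = visits j c k"
    using assms(2)
  proof (induction m rule: dec_induct)
    case base
    show ?case using assms(1) by simp
  next
    case (step m)
    then have "run c (Suc m) = run c m" using run_Suc_halted by blast
    then show ?case using step.IH by (auto simp: halted_def)
  qed
  then show "run c m = run c k" "halted c m" "crossings A c m = crossings A c k"
    "visits j c m = visits j c k" by auto
qed

lemma crossings_mono: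
  assumes "k \<le> m"
  shows "prefix (crossings A c k) (crossings A c m)"
  using assms by (induction m rule: dec_induct) auto

lemma prefix_crossings_halted:
  assumes "halted c T"
  shows "prefix (crossings A c k) (crossings A c T)"
  using crossings_mono[of k T A c] halted_mono(3)[OF assms, of k A] by (cases "k \<le> T") auto

lemma crossings_Compl [simp]: "crossings (- A) c k = crossings A c k"
  by (induction k) auto

text \<open>Without a new crossing the head stays in \<open>A\<close>, so cells outside of
  \<open>A\<close> are neither rewritten nor visited.\<close>

lemma unchanged_between_crossings:
  assumes "k \<le> m" "pos (run c k) \<in> A" "crossings A c m = crossings A c k"
  shows "pos (run c m) \<in> A"
    and "j \<notin> A \<Longrightarrow> tape (run c m) j = tape (run c k) j \<and> visits j c m = visits j c k"
proof -
  have "pos (run c m) \<in> A \<and>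
      (j \<notin> A \<longrightarrow> tape (run c m) j = tape (run c k) j \<and> visits j c m = visits j c k)"
    using assms(1,3)
  proof (induction m rule: dec_induct)
    case base
    show ?case using assms(2) by simp
  next
    case (step m)
    have "prefix (crossings A c k) (crossings A c m)" "prefix (crossings A c m) (crossings A c (Suc m))"
      using crossings_mono step.hyps by (blast, simp)
    then have eq: "crossings A c m = crossings A c k"
      using step.prems by (metis prefix_order.antisym)
    note IH = step.IH[OF eq]
    moreover have "pos (run c (Suc m)) \<in> A"
      using IH step.prems eq by (auto split: if_splits)
    moreover have "j \<noteq> pos (run c m)" if "j \<notin> A" using IH that by blast
    ultimately show ?case using tape_run_Suc[of j c m] by auto
  qed
  then show "pos (run c m) \<in> A"
    and "j \<notin> A \<Longrightarrow> tape (run c m) j = tape (run c k) j \<and> visits j c m = visits j c k" by auto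
qed

text \<open>The time \<open>s\<close> is the last moment before the next crossing, with the head
  still in \<open>A\<close>.\<close>

lemma next_crossing:
  assumes "k \<le> m" "pos (run c k) \<in> A" "crossings A c m \<noteq> crossings A c k"
  obtains s where "k \<le> s" "crossings A c s = crossings A c k" "pos (run c s) \<in> A"
    "pos (run c (Suc s)) \<notin> A"
proof -
  have "\<exists>s\<ge>k. crossings A c s = crossings A c k \<and> pos (run c s) \<in> A \<and> pos (run c (Suc s)) \<notin> A"
    using assms(1,3)
  proof (induction m rule: dec_induct)
    case (step m)
    show ?case
    proof (cases "crossings A c m = crossings A c k")
      case True
      then have "pos (run c m) \<in> A" using unchanged_between_crossings step.hyps assms(2) by blast
      then show ?thesis using True step by (intro exI[of _ m]) (auto split: if_splits)
    qed (use step in blast)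
  qed simp
  then show ?thesis using that by blast
qed

text \<open>\<open>A\<close> is a half-line, and \<open>a\<close> and \<open>b\<close> are the cells on the two sides of its border.\<close>

definition border :: "int set \<Rightarrow> int \<Rightarrow> int \<Rightarrow> bool" where
  "border A a b \<longleftrightarrow> (\<forall>i j. i \<in> A \<longrightarrow> j \<notin> A \<longrightarrow> \<bar>i - j\<bar> = 1 \<longrightarrow> i = a \<and> j = b)"

lemma border_Compl: "border A a b \<Longrightarrow> border (- A) b a"
  unfolding border_def by (metis Compl_iff abs_minus_commute)

text \<open>While the head of the third run is in \<open>A\<close>, it follows the first run; outside of \<open>A\<close>, its tape
  shows what the second run left there when its head last moved into \<open>A\<close>. The roles of the first
  two runs are swapped together with \<open>A\<close> and \<open>- A\<close> at each crossing.\<close>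

definition spliced :: "int set \<Rightarrow> config \<Rightarrow> config \<Rightarrow> config \<Rightarrow> nat \<Rightarrow> nat \<Rightarrow> nat \<Rightarrow> bool" where
  "spliced A c1 c2 c3 k1 k2 k3 \<longleftrightarrow>
     fst (run c3 k3) = fst (run c1 k1) \<and> pos (run c3 k3) = pos (run c1 k1) \<and>
     pos (run c1 k1) \<in> A \<and> pos (run c2 k2) \<in> A \<and> crossings A c1 k1 = crossings A c2 k2 \<and>
     (\<forall>j\<in>A. tape (run c3 k3) j = tape (run c1 k1) j \<and> visits j c3 k3 = visits j c1 k1) \<and>
     (\<forall>j\<in>-A. tape (run c3 k3) j = tape (run c2 k2) j \<and> visits j c3 k3 = visits j c2 k2)"

text \<open>As long as the first run stays in \<open>A\<close>, the third one copies its steps. When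
  the first run leaves \<open>A\<close>, the equality of the complete crossing sequences forces the
  second run to leave \<open>A\<close> later in the same state; the third run then continues as the
  second one from there.\<close>

lemma spliced_step:
  assumes border: "border A a b" and sp: "spliced A c1 c2 c3 k1 k2 k3"
    and T: "halted c1 T" "halted c2 T" "crossings A c1 T = crossings A c2 T"
  shows "spliced A c1 c2 c3 (Suc k1) k2 (Suc k3) \<or>
    (\<exists>s. spliced (- A) c2 c1 c3 (Suc s) (Suc k1) (Suc k3))"
proof (cases "halted c3 k3")
  case True
  then have "halted c1 k1" using sp by (simp add: halted_def spliced_def)
  then show ?thesis using sp True
    by (auto simp: spliced_def halted_mono[OF True, of "Suc k3"] run_Suc_halted)
next
  case False
  then have nh: "\<not> halted c1 k1" using sp by (simp add: halted_def spliced_def)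
  let ?h = "pos (run c1 k1)"
  have same: "fst (run c3 k3) = fst (run c1 k1)" "pos (run c3 k3) = ?h" "?h \<in> A"
    "pos (run c2 k2) \<in> A" "crossings A c1 k1 = crossings A c2 k2"
    and inA: "\<And>j. j \<in> A \<Longrightarrow> tape (run c3 k3) j = tape (run c1 k1) j \<and> visits j c3 k3 = visits j c1 k1"
    and offA: "\<And>j. j \<notin> A \<Longrightarrow> tape (run c3 k3) j = tape (run c2 k2) j \<and> visits j c3 k3 = visits j c2 k2"
    using sp by (auto simp: spliced_def)
  have read: "tape (run c3 k3) ?h = tape (run c1 k1) ?h" using inA same by blast
  obtain p w d where tr: "trans M (fst (run c1 k1)) (tape (run c1 k1) ?h) = (p, w, d)"
    and 1: "run c1 (Suc k1) = (p, (tape (run c1 k1))(?h := w),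
       case d of L \<Rightarrow> ?h - 1 | R \<Rightarrow> ?h + 1)"
    using run_Suc_cases[OF nh] by blast
  have 3: "run c3 (Suc k3) = (p, (tape (run c3 k3))(?h := w),
       case d of L \<Rightarrow> ?h - 1 | R \<Rightarrow> ?h + 1)"
    by (rule run_Suc_cases[OF False]) (simp add: same read tr split: dir.splits)
  have st: "fst (run c3 (Suc k3)) = fst (run c1 (Suc k1))" "pos (run c3 (Suc k3)) = pos (run c1 (Suc k1))"
    using 1 3 by auto
  have inA': "tape (run c3 (Suc k3)) j = tape (run c1 (Suc k1)) j \<and>
      visits j c3 (Suc k3) = visits j c1 (Suc k1)" if "j \<in> A" for j
    using inA[OF that] 1 3 same False nh by auto
  have offA': "tape (run c3 (Suc k3)) j = tape (run c2 k2) j \<and>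
      visits j c3 (Suc k3) = visits j c2 k2" if "j \<notin> A" for j
    using offA[OF that] 3 same that by auto
  show ?thesis
  proof (cases "pos (run c1 (Suc k1)) \<in> A")
    case True
    then have "crossings A c1 (Suc k1) = crossings A c1 k1" using same by simp
    then show ?thesis using st inA' offA' same True unfolding spliced_def by auto
  next
    case out: False
    let ?X = "crossings A c2 k2"
    have X1: "crossings A c1 (Suc k1) = ?X @ [p]" using out same 1 by simp
    \<comment> \<open>The common complete sequence continues \<open>?X\<close> with
      \<open>p\<close>, so the crossings of the second run do not end with \<open>?X\<close> and its
      next one has state \<open>p\<close>.\<close>
    have tot: "prefix (?X @ [p]) (crossings A c2 T)"
      using prefix_crossings_halted[OF T(1), of A "Suc k1"] X1 T(3) by simp
    then have ne: "crossings A c2 T \<noteq> ?X" by (auto simp: prefix_def)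
    then have "k2 \<le> T" using halted_mono(3)[OF T(2), of k2 A] by force
    then obtain s where s: "k2 \<le> s" "crossings A c2 s = ?X" "pos (run c2 s) \<in> A"
      "pos (run c2 (Suc s)) \<notin> A"
      using next_crossing[OF _ _ ne] same(4) by metis
    then have nh2: "\<not> halted c2 s" using run_Suc_halted[of c2 s] by auto
    have X2: "crossings A c2 (Suc s) = ?X @ [fst (run c2 (Suc s))]" using s by simp
    have "prefix (?X @ [fst (run c2 (Suc s))]) (crossings A c2 T)"
      using prefix_crossings_halted[OF T(2), of A "Suc s"] X2 by simp
    with tot have p: "fst (run c2 (Suc s)) = p" by (auto simp: prefix_def)
    \<comment> \<open>A step moves the head by one cell, and only one pair of neighbouring cells is
      separated by the border.\<close>
    have "pos (run c2 (Suc s)) = b" "pos (run c1 (Suc k1)) = b"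
      using border pos_run_Suc[OF nh2] pos_run_Suc[OF nh] s same out unfolding border_def by blast+
    then have pos: "pos (run c2 (Suc s)) = pos (run c1 (Suc k1))" by simp
    have "tape (run c2 (Suc s)) j = tape (run c2 k2) j \<and> visits j c2 (Suc s) = visits j c2 k2"
      if "j \<notin> A" for j
    proof -
      have "j \<noteq> pos (run c2 s)" using that s by blast
      then show ?thesis
        using unchanged_between_crossings(2)[OF s(1) same(4) s(2) that] tape_run_Suc by simp
    qed
    then have "spliced (- A) c2 c1 c3 (Suc s) (Suc k1) (Suc k3)"
      unfolding spliced_def
      using st pos p 1 s out X1 X2 inA' offA' by (simp del: crossings.simps visits.simps)
    then show ?thesis by blast
  qed
qed

text \<open>Once the third run has halted, so has the run that it follows; what remains is to
  compare the times \<open>k1\<close> and \<open>k2\<close> with \<open>T\<close>.\<close>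

lemma spliced_halted:
  assumes sp: "spliced A c1 c2 c3 k1 k2 T"
    and T: "halted c1 T" "halted c2 T" "halted c3 T" "crossings A c1 T = crossings A c2 T"
  shows "fst (run c3 T) = fst (run c1 T)"
    "j \<in> A \<Longrightarrow> visits j c3 T = visits j c1 T" "j \<notin> A \<Longrightarrow> visits j c3 T = visits j c2 T"
proof -
  have h1: "halted c1 k1" using sp T(3) by (simp add: spliced_def halted_def)
  have eq1: "run c1 T = run c1 k1" "visits j c1 T = visits j c1 k1"
      "crossings A c1 T = crossings A c1 k1" for j
    using halted_mono[OF h1] halted_mono[OF T(1)] by (metis nat_le_linear)+
  show "fst (run c3 T) = fst (run c1 T)"
    using sp eq1 by (simp add: spliced_def)
  show "visits j c3 T = visits j c1 T" if "j \<in> A"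
    using sp eq1 that by (simp add: spliced_def)
  \<comment> \<open>At time \<open>k2\<close> the second run has made all its crossings, so it stays
    in \<open>A\<close> afterwards and its visits outside of \<open>A\<close> are complete.\<close>
  have eq2: "crossings A c2 T = crossings A c2 k2" "pos (run c2 k2) \<in> A"
    using sp T(4) eq1 by (simp_all add: spliced_def)
  have "visits j c2 T = visits j c2 k2" if "j \<notin> A"
  proof (cases "k2 \<le> T")
    case True
    then show ?thesis using unchanged_between_crossings(2)[OF True eq2(2,1) that] by simp
  next
    case False
    then show ?thesis using halted_mono(4)[OF T(2), of k2 j] by simp
  qed
  then show "visits j c3 T = visits j c2 T" if "j \<notin> A"
    using sp that by (simp add: spliced_def)
qed

text \<open>The final state comes from the run followed at the end, and the third run may halt on
  either side of the border. Hence there are two possible values.\<close>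

lemma splice:
  assumes border: "border A a b"
    and init: "fst c1 = fst c3" "fst c2 = fst c3" "pos c1 = pos c3" "pos c1 \<in> A" "pos c2 \<in> A"
      "\<And>j. j \<in> A \<Longrightarrow> tape c3 j = tape c1 j" "\<And>j. j \<notin> A \<Longrightarrow> tape c3 j = tape c2 j"
    and T: "halted c1 T" "halted c2 T" "halted c3 T" "crossings A c1 T = crossings A c2 T"
  shows "fst (run c3 T) \<in> {fst (run c1 T), fst (run c2 T)}"
    "\<And>j. j \<in> A \<Longrightarrow> visits j c3 T = visits j c1 T"
    "\<And>j. j \<notin> A \<Longrightarrow> visits j c3 T = visits j c2 T"
proof -
  have "(\<exists>k1 k2. spliced A c1 c2 c3 k1 k2 k) \<or> (\<exists>k1 k2. spliced (- A) c2 c1 c3 k1 k2 k)" for k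
  proof (induction k)
    case 0
    have "spliced A c1 c2 c3 0 0 0" using init by (simp add: spliced_def)
    then show ?case by blast
  next
    case (Suc k)
    then consider k1 k2 where "spliced A c1 c2 c3 k1 k2 k" | k1 k2 where "spliced (- A) c2 c1 c3 k1 k2 k"
      by blast
    then show ?case
    proof cases
      case 1
      show ?thesis using spliced_step[OF border 1 T(1,2,4)] by blast
    next
      case 2
      show ?thesis using spliced_step[OF border_Compl[OF border] 2 T(2,1)] T(4) by auto
    qed
  qed
  then consider k1 k2 where "spliced A c1 c2 c3 k1 k2 T" | k1 k2 where "spliced (- A) c2 c1 c3 k1 k2 T"
    by blast
  then have "fst (run c3 T) \<in> {fst (run c1 T), fst (run c2 T)} \<and>
    (\<forall>j. (j \<in> A \<longrightarrow> visits j c3 T = visits j c1 T) \<and> (j \<notin> A \<longrightarrow> visits j c3 T = visits j c2 T))"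
  proof cases
    case 1
    show ?thesis using spliced_halted[OF 1 T] by blast
  next
    case 2
    show ?thesis using spliced_halted[OF 2 T(2,1,3)] T(4) by auto
  qed
  then show "fst (run c3 T) \<in> {fst (run c1 T), fst (run c2 T)}"
    "\<And>j. j \<in> A \<Longrightarrow> visits j c3 T = visits j c1 T"
    "\<And>j. j \<notin> A \<Longrightarrow> visits j c3 T = visits j c2 T" by blast+
qed

text \<open>Translation of the coordinates. Prefixes of different lengths have their borders at
  different cells, which must be made to coincide before splicing.\<close>

definition shift :: "int \<Rightarrow> config \<Rightarrow> config" where
  "shift s c = (fst c, (\<lambda>j. tape c (j + s)), pos c - s)"

lemma shift_simps [simp]:
  "fst (shift s c) = fst c" "tape (shift s c) j = tape c (j + s)" "pos (shift s c) = pos c - s"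
  by (simp_all add: shift_def)

lemma run_shift: "run (shift s c) k = shift s (run c k)"
proof (induction k)
  case (Suc k)
  show ?case
  proof (cases "halted c k")
    case True
    then have "halted (shift s c) k" using Suc by (simp add: halted_def)
    then show ?thesis using True Suc by (simp add: run_Suc_halted)
  next
    case False
    have "tm_step M (shift s c') = shift s (tm_step M c')" if "\<not> halting M (fst c')" for c'
      using that by (cases c'; cases "trans M (fst c') (tape c' (pos c'))")
        (auto simp: shift_def fun_eq_iff split: dir.splits)
    then show ?thesis using False Suc by (simp add: run_Suc halted_def)
  qed
qed simp

lemma halted_shift [simp]: "halted (shift s c) k = halted c k"
  by (simp add: halted_def run_shift)

lemma visits_shift: "visits j (shift s c) k = visits (j + s) c k"
  by (induction k) (auto simp: run_shift)

lemma crossings_shift: "crossings {..<a} (shift s c) k = crossings {..<a + s} c k"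
  by (induction k) (auto simp: run_shift)

end

section \<open>Linear-time machines have bounded crossing sequences\<close>

text \<open>Every crossing of this border is a proper step that starts in one of the two adjacent
  cells.\<close>

lemma length_crossings_le_visits:
  "length (crossings M {..<i} c k) \<le> visits M (i - 1) c k + visits M i c k"
proof (induction k)
  case (Suc k)
  have "pos (run M c k) = i - 1 \<or> pos (run M c k) = i"
    if "\<not> (pos (run M c k) < i \<longleftrightarrow> pos (run M c (Suc k)) < i)"
    using pos_run_Suc[of M c k] run_Suc_halted[of M c k] that by (cases "halted M c k") auto
  moreover have "\<not> halted M c k" if "\<not> (pos (run M c k) < i \<longleftrightarrow> pos (run M c (Suc k)) < i)"
    using run_Suc_halted[of M c k] that by auto
  ultimately show ?case using Suc by (auto simp: of_bool_def)
qed simp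

lemma visits_le: "visits M j c k \<le> k"
  by (induction k) (auto simp: of_bool_def)

text \<open>Each step of the head crosses at most one border.\<close>

lemma sum_length_crossings_le: "(\<Sum>i = 1..n. length (crossings M {..<int i} c k)) \<le> k"
proof (induction k)
  case (Suc k)
  let ?P = "\<lambda>i. \<not> (pos (run M c k) < int i \<longleftrightarrow> pos (run M c (Suc k)) < int i)"
  have "\<bar>pos (run M c k) - pos (run M c (Suc k))\<bar> \<le> 1"
    using pos_run_Suc[of M c k] run_Suc_halted[of M c k] by (cases "halted M c k") auto
  then have "card {i\<in>{1..n}. ?P i} \<le> Suc 0"
    by (subst card_le_Suc0_iff_eq) auto
  moreover have "(\<Sum>i = 1..n. length (crossings M {..<int i} c (Suc k)))
      = (\<Sum>i = 1..n. length (crossings M {..<int i} c k) + of_bool (?P i))"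
    by (intro sum.cong) auto
  ultimately show ?case using Suc by (simp add: sum.distrib Int_def)
qed simp

locale linear_time_tm =
  fixes M :: tm and C D :: nat
  assumes wf: "wf_tm M" and time: "runs_in_time M (\<lambda>n. C * n + D)"
begin

section \<open>Complete runs on input words\<close>

definition input_words :: "nat list set" where
  "input_words = {w. set w \<subseteq> {..<num_inputs M}}"

definition time_bound :: "nat list \<Rightarrow> nat" where
  "time_bound w = C * length w + D"

definition crossing_seq :: "nat list \<Rightarrow> nat \<Rightarrow> nat list" where
  "crossing_seq w i = crossings M {..<int i} (init_config M w) (time_bound w)"

definition visit_count :: "nat list \<Rightarrow> int \<Rightarrow> nat" where
  "visit_count w j = visits M j (init_config M w) (time_bound w)"

definition final_state :: "nat list \<Rightarrow> nat" where
  "final_state w = fst (run M (init_config M w) (time_bound w))"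

lemma input_words_append [simp]: "x @ z \<in> input_words \<longleftrightarrow> x \<in> input_words \<and> z \<in> input_words"
  by (auto simp: input_words_def)

lemma state_after_run: "state_after M w k = fst (run M (init_config M w) k)"
  by (simp add: state_after_def run_def)

lemma halted_time_bound: "w \<in> input_words \<Longrightarrow> halted M (init_config M w) (time_bound w)"
  using time unfolding runs_in_time_def halted_def input_words_def time_bound_def
  by (auto simp: state_after_run)

text \<open>All quantities are final at the time bound, so runs on words of different lengths can be
  compared at a common later time.\<close>

lemma time_bound_mono:
  assumes "w \<in> input_words" "time_bound w \<le> T"
  shows "halted M (init_config M w) T" "visits M j (init_config M w) T = visit_count w j"
    "crossings M {..<int i} (init_config M w) T = crossing_seq w i"
    "fst (run M (init_config M w) T) = final_state w"
  using halted_mono[OF halted_time_bound[OF assms(1)] assms(2)]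
  by (simp_all add: visit_count_def crossing_seq_def final_state_def)

lemma tm_lang_iff: "w \<in> tm_lang M \<longleftrightarrow> w \<in> input_words \<and> final_state w = acc_state M"
proof -
  have "final_state w = acc_state M" if "w \<in> input_words" "state_after M w k = acc_state M" for k
  proof -
    have h: "halted M (init_config M w) k"
      using that(2) by (simp add: halted_def halting_def state_after_run)
    show ?thesis
    proof (cases "k \<le> time_bound w")
      case True
      then show ?thesis using halted_mono(1)[OF h True] that(2)
        by (simp add: final_state_def state_after_run)
    next
      case False
      then show ?thesis using time_bound_mono(4)[OF that(1), of k] that(2)
        by (simp add: state_after_run)
    qed
  qed
  then show ?thesis
    by (auto simp: tm_lang_def input_words_def final_state_def state_after_run)
qed

text \<open>The prefixes are nonempty so that the head, which starts at cell 0, is initially to the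
  left of the border.\<close>

lemma word_splice:
  assumes x: "x1 \<noteq> []" "x2 \<noteq> []" and w: "x1 @ z1 \<in> input_words" "x2 @ z2 \<in> input_words"
    and eq: "crossing_seq (x1 @ z1) (length x1) = crossing_seq (x2 @ z2) (length x2)"
  shows "final_state (x1 @ z2) \<in> {final_state (x1 @ z1), final_state (x2 @ z2)}"
    "j < int (length x1) \<Longrightarrow> visit_count (x1 @ z2) j = visit_count (x1 @ z1) j"
    "j \<ge> int (length x2) \<Longrightarrow>
      visit_count (x1 @ z2) (j - (int (length x2) - int (length x1))) = visit_count (x2 @ z2) j"
proof -
  \<comment> \<open>By this time all three runs have halted.\<close>
  define T where "T = time_bound (x1 @ z1) + time_bound (x2 @ z2) + time_bound (x1 @ z2)"
  let ?s = "int (length x2) - int (length x1)"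
  let ?c1 = "init_config M (x1 @ z1)" and ?c3 = "init_config M (x1 @ z2)"
  let ?c2 = "shift ?s (init_config M (x2 @ z2))"
  let ?A = "{..<int (length x1)}"
  have w3: "x1 @ z2 \<in> input_words" using w by simp
  note T1 = time_bound_mono[OF w(1), of T] and T2 = time_bound_mono[OF w(2), of T]
    and T3 = time_bound_mono[OF w3, of T]
  have border: "border ?A (int (length x1) - 1) (int (length x1))"
    by (auto simp: border_def)
  have "crossings M ?A ?c1 T = crossings M ?A ?c2 T"
    using T1(3) T2(3)[of "length x2"] eq by (simp add: crossings_shift T_def)
  moreover have "tape ?c3 j = tape ?c1 j" if "j \<in> ?A" for j
    using that by (auto simp: init_config_def nth_append nat_less_iff)
  moreover have "tape ?c3 j = tape ?c2 j" if "j \<notin> ?A" for j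
  proof -
    \<comment> \<open>To the right of the border both sides are the index within
      \<open>z2\<close>.\<close>
    have "nat (j + ?s) - length x2 = nat j - length x1" using that by auto
    then show ?thesis using that by (auto simp: init_config_def nth_append nat_less_iff)
  qed
  moreover have "halted M ?c1 T" "halted M ?c2 T" "halted M ?c3 T"
    using T1 T2 T3 by (simp_all add: T_def)
  ultimately have *: "fst (run M ?c3 T) \<in> {fst (run M ?c1 T), fst (run M ?c2 T)}"
    "\<And>j. j \<in> ?A \<Longrightarrow> visits M j ?c3 T = visits M j ?c1 T"
    "\<And>j. j \<notin> ?A \<Longrightarrow> visits M j ?c3 T = visits M j ?c2 T"
    using splice[OF border, of ?c1 ?c3 ?c2 M T] x by (auto simp: init_config_def)
  show "final_state (x1 @ z2) \<in> {final_state (x1 @ z1), final_state (x2 @ z2)}"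
    using *(1) T1(4) T2(4) T3(4) by (simp add: T_def run_shift)
  show "visit_count (x1 @ z2) j = visit_count (x1 @ z1) j" if "j < int (length x1)"
    using *(2)[of j] that T1(2) T3(2) by (simp add: T_def)
  show "visit_count (x1 @ z2) (j - ?s) = visit_count (x2 @ z2) j" if "j \<ge> int (length x2)"
    using *(3)[of "j - ?s"] that T2(2) T3(2) by (simp add: T_def visits_shift)
qed

text \<open>The bound on states makes crossing sequences words over a finite alphabet. Both bounds
  keep the simulation inside the transition table.\<close>

lemma run_wf:
  assumes "w \<in> input_words"
  shows "fst (run M (init_config M w) k) < num_states M" "tape (run M (init_config M w) k) j < num_syms M"
proof -
  have "fst (run M (init_config M w) k) < num_states M \<and>
      (\<forall>j. tape (run M (init_config M w) k) j < num_syms M)"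
  proof (induction k)
    case 0
    have "w ! nat j < num_inputs M" if "0 \<le> j" "j < int (length w)" for j
      using assms that by (auto simp: input_words_def nat_less_iff subset_iff)
    then show ?case using wf by (fastforce simp: init_config_def wf_tm_def)
  next
    case (Suc k)
    show ?case
    proof (cases "halted M (init_config M w) k")
      case True
      then show ?thesis using Suc by (simp add: run_Suc_halted)
    next
      case False
      then obtain p b d where 1: "trans M (fst (run M (init_config M w) k))
          (tape (run M (init_config M w) k) (pos (run M (init_config M w) k))) = (p, b, d)"
        and 2: "run M (init_config M w) (Suc k) = (p, (tape (run M (init_config M w) k))
          (pos (run M (init_config M w) k) := b), case d of L \<Rightarrow> pos (run M (init_config M w) k) - 1
            | R \<Rightarrow> pos (run M (init_config M w) k) + 1)"
        by (rule run_Suc_cases)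
      have "\<not> halting M (fst (run M (init_config M w) k))" using False by (simp add: halted_def)
      then have "p < num_states M \<and> b < num_syms M"
        using wf conjunct1[OF Suc] spec[OF conjunct2[OF Suc]] 1 unfolding wf_tm_def
        by (metis prod.inject)
      then show ?thesis using Suc 2 by simp
    qed
  qed
  then show "fst (run M (init_config M w) k) < num_states M"
    "tape (run M (init_config M w) k) j < num_syms M" by auto
qed

lemma set_crossing_seq: "w \<in> input_words \<Longrightarrow> set (crossing_seq w i) \<subseteq> {..<num_states M}"
proof -
  assume w: "w \<in> input_words"
  have "set (crossings M A (init_config M w) k) \<subseteq> {..<num_states M}" for A k
    by (induction k) (use run_wf(1)[OF w] in auto)
  then show ?thesis by (simp add: crossing_seq_def)
qed

section \<open>A bound on visits that does not depend on the word\<close>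

definition short_seqs :: "nat \<Rightarrow> nat list set" where
  "short_seqs l = {c. set c \<subseteq> {..<num_states M} \<and> length c \<le> l}"

lemma finite_short_seqs [simp]: "finite (short_seqs l)"
  unfolding short_seqs_def by (intro finite_lists_length_le) simp

lemma card_short_seqs: "card (short_seqs l) = (\<Sum>i\<le>l. num_states M ^ i)"
  unfolding short_seqs_def by (subst card_lists_length_le) auto

text \<open>The time bound for words of length \<open>D + 4 * card (short_seqs (2 * C + 1))\<close>,
  above which a word can be shortened.\<close>

definition visit_bound :: nat where
  "visit_bound = C * (D + 4 * card (short_seqs (2 * C + 1))) + D"

text \<open>In a long word there are many borders with short crossing sequences, because the crossing
  sequences have total length at most \<open>C n + D\<close>. Two of them on the same side of the cell \<open>j\<close>
  agree, and cutting out what is between them preserves the number of visits to \<open>j\<close>.\<close>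

lemma visit_count_le: "w \<in> input_words \<Longrightarrow> visit_count w j \<le> visit_bound"
proof (induction "length w" arbitrary: w j rule: less_induct)
  case less
  let ?n = "length w" and ?S = "short_seqs (2 * C + 1)"
  show ?case
  proof (cases "?n \<le> D + 4 * card ?S")
    case True
    have "visit_count w j \<le> C * ?n + D"
      using visits_le[of M j "init_config M w" "time_bound w"]
      by (simp add: visit_count_def time_bound_def)
    also have "\<dots> \<le> visit_bound" using True by (simp add: visit_bound_def)
    finally show ?thesis .
  next
    case False
    define I where "I = {i\<in>{1..?n}. length (crossing_seq w i) \<le> 2 * C + 1}"
    have I: "I \<subseteq> {1..?n}" "finite I" by (auto simp: I_def)
    have "(2 * C + 2) * (?n - card I) = (\<Sum>i\<in>{1..?n} - I. 2 * C + 2)"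
      using I by (simp add: card_Diff_subset mult.commute)
    also have "\<dots> \<le> (\<Sum>i\<in>{1..?n} - I. length (crossing_seq w i))"
      by (intro sum_mono) (auto simp: I_def)
    also have "\<dots> \<le> (\<Sum>i = 1..?n. length (crossing_seq w i))"
      by (intro sum_mono2) auto
    also have "\<dots> \<le> C * ?n + D"
      using sum_length_crossings_le by (simp add: crossing_seq_def time_bound_def)
    \<comment> \<open>Every border outside of \<open>I\<close> accounts for at least
      \<open>2 * C + 2\<close> crossings.\<close>
    finally have le: "(2 * C + 2) * (?n - card I) \<le> C * ?n + D" .
    \<comment> \<open>Twice the number of short sequences, because a border is also classified by
      its side of \<open>j\<close>. With fewer borders in \<open>I\<close>, \<open>le\<close> would
      give \<open>(2 * C + 2) * (?n - 2 * card ?S) \<le> C * ?n + D\<close>, which fails for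
      \<open>?n > D + 4 * card ?S\<close>.\<close>
    have card: "card I > 2 * card ?S"
    proof (rule ccontr)
      assume "\<not> card I > 2 * card ?S"
      then have "?n - 2 * card ?S \<le> ?n - card I" by simp
      then have "(2 * C + 2) * (?n - 2 * card ?S) \<le> C * ?n + D"
        using le by (meson le_trans mult_le_mono2)
      moreover obtain m where m: "?n = D + 4 * card ?S + Suc m"
        using False by (metis add_Suc_right less_imp_Suc_add not_le)
      ultimately show False by (simp add: algebra_simps)
    qed
    let ?f = "\<lambda>i. (crossing_seq w i, int i \<le> j)"
    have "?f ` I \<subseteq> ?S \<times> UNIV"
      using set_crossing_seq[OF less.prems] by (auto simp: I_def short_seqs_def)
    then have "card (?f ` I) \<le> card (?S \<times> (UNIV :: bool set))"
      by (intro card_mono) auto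
    then have "\<not> inj_on ?f I"
      using card by (auto dest: card_image simp: card_cartesian_product)
    then obtain a b where "a \<in> I" "b \<in> I" "a \<noteq> b" "?f a = ?f b"
      by (auto simp: inj_on_def)
    then obtain a b where ab: "a \<in> I" "b \<in> I" "a < b" "?f a = ?f b"
      by (metis linorder_neq_iff)
    then have len: "1 \<le> a" "a < b" "b \<le> ?n" by (auto simp: I_def)
    let ?w = "take a w @ drop b w"
    have ne: "take a w \<noteq> []" "take b w \<noteq> []" using len by auto
    have parts: "take i w \<in> input_words" "drop i w \<in> input_words" for i
      using less.prems by (auto simp: input_words_def dest: in_set_takeD in_set_dropD)
    have w: "take a w @ drop a w \<in> input_words" "take b w @ drop b w \<in> input_words"
      using less.prems by (simp_all only: append_take_drop_id)
    have eq: "crossing_seq (take a w @ drop a w) (length (take a w)) =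
        crossing_seq (take b w @ drop b w) (length (take b w))"
      using ab len by simp
    note splice = word_splice(2,3)[OF ne w eq]
    have "?w \<in> input_words" using parts by simp
    moreover have "length ?w < length w" using len by simp
    ultimately have IH: "visit_count ?w i \<le> visit_bound" for i
      by (rule less.hyps[rotated])
    show ?thesis
    proof (cases "int a \<le> j")
      case True
      then have "int b \<le> j" using ab by simp
      then show ?thesis using splice(2)[of j] IH[of "j - (int b - int a)"] len by simp
    next
      case False
      then show ?thesis using splice(1)[of j] IH[of j] len by simp
    qed
  qed
qed

text \<open>A nonempty word \<open>x\<close> is classified by its \<open>profile\<close>, a set of pairs of a crossing sequence at the
  right border of \<open>x\<close> and a final state. The successor counts the empty word, for which
  the head starts on the other side of the border.\<close>

definition index_bound :: nat where
  "index_bound = Suc (2 ^ (card (short_seqs (2 * visit_bound)) * num_states M))"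

definition profile :: "nat list \<Rightarrow> (nat list \<times> nat) set" where
  "profile x = (\<lambda>z. (crossing_seq (x @ z) (length x), final_state (x @ z))) ` input_words"

text \<open>If \<open>x @ z\<close> is accepted, equal profiles provide an accepted
  \<open>x' @ z'\<close> with the same crossing sequence. Splicing \<open>x'\<close> with
  \<open>z\<close> yields the final state of one of these two runs, and both accept.\<close>

lemma left_quotient_profile:
  assumes "x \<in> input_words - {[]}" "x' \<in> input_words - {[]}" "profile x = profile x'"
  shows "left_quotient (tm_lang M) x = left_quotient (tm_lang M) x'"
proof -
  have "left_quotient (tm_lang M) x \<subseteq> left_quotient (tm_lang M) x'"
    if x: "x \<in> input_words - {[]}" "x' \<in> input_words - {[]}" "profile x = profile x'" for x x'
  proof
    fix z assume "z \<in> left_quotient (tm_lang M) x"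
    then have z: "z \<in> input_words" "final_state (x @ z) = acc_state M"
      by (auto simp: left_quotient_def tm_lang_iff)
    then have "(crossing_seq (x @ z) (length x), acc_state M) \<in> profile x'"
      using x(3) by (force simp: profile_def)
    then obtain z' where z': "z' \<in> input_words" "final_state (x' @ z') = acc_state M"
      "crossing_seq (x' @ z') (length x') = crossing_seq (x @ z) (length x)"
      by (auto simp: profile_def)
    have "final_state (x' @ z) = acc_state M"
      using word_splice(1)[of x' x z' z] x z z' by auto
    then show "z \<in> left_quotient (tm_lang M) x'"
      using x z by (auto simp: left_quotient_def tm_lang_iff)
  qed
  with assms show ?thesis by blast
qed

lemma length_crossing_seq_le: "w \<in> input_words \<Longrightarrow> length (crossing_seq w i) \<le> 2 * visit_bound"
  using length_crossings_le_visits[of M "int i" "init_config M w" "time_bound w"]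
    visit_count_le[of w "int i"] visit_count_le[of w "int i - 1"]
  by (simp add: crossing_seq_def visit_count_def)

lemma card_left_quotients:
  "finite (left_quotient (tm_lang M) ` input_words)"
  "card (left_quotient (tm_lang M) ` input_words) \<le> index_bound"
proof -
  let ?Q = "left_quotient (tm_lang M)" and ?W = "input_words - {[]}"
  let ?P = "short_seqs (2 * visit_bound) \<times> {..<num_states M}"
  \<comment> \<open>Choosing a representative of each profile makes the quotient a function of the
    profile, so quotients of nonempty words are no more numerous than profiles.\<close>
  define g where "g = (\<lambda>P. ?Q (SOME x. x \<in> ?W \<and> profile x = P))"
  have g: "?Q x = g (profile x)" if "x \<in> ?W" for x
  proof -
    let ?y = "SOME y. y \<in> ?W \<and> profile y = profile x"
    have "?y \<in> ?W \<and> profile ?y = profile x"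
      using that by (intro someI[of "\<lambda>y. y \<in> ?W \<and> profile y = profile x"]) blast
    then show ?thesis using left_quotient_profile[OF that, of ?y] by (simp add: g_def)
  qed
  have "(crossing_seq (x @ z) (length x), final_state (x @ z)) \<in> ?P"
    if "x \<in> input_words" "z \<in> input_words" for x z
    using that set_crossing_seq[of "x @ z" "length x"] length_crossing_seq_le[of "x @ z" "length x"]
      run_wf(1)[of "x @ z"]
    by (simp add: short_seqs_def final_state_def)
  then have "profile x \<subseteq> ?P" if "x \<in> input_words" for x
    using that by (auto simp: profile_def)
  then have sub: "?Q ` input_words \<subseteq> insert (?Q []) (g ` Pow ?P)"
    using g by blast
  then show "finite (?Q ` input_words)"
    by (rule finite_subset) simp
  have "card (?Q ` input_words) \<le> card (insert (?Q []) (g ` Pow ?P))"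
    using sub by (rule card_mono[rotated]) simp
  also have "\<dots> \<le> Suc (card (g ` Pow ?P))"
    by (simp add: card_insert_if del: Pow_insert)
  also have "card (g ` Pow ?P) \<le> card (Pow ?P)"
    by (rule card_image_le) simp
  finally show "card (?Q ` input_words) \<le> index_bound"
    by (simp add: index_bound_def card_cartesian_product card_Pow)
qed

end

section \<open>Search for the automaton\<close>

text \<open>The number \<open>p\<close> pairs the state with the code of the unread word. Nothing
  changes once the word is used up, so surplus iterations are harmless.\<close>

definition dfa_step_code :: "nat \<Rightarrow> nat \<Rightarrow> nat" where
  "dfa_step_code c p =
     (if snd (prod_decode p) = 0 then p
      else prod_encode
        (nth_code (nth_code (nth_code c 4) (fst (prod_decode p))) (hd_code (snd (prod_decode p))),
         tl_code (snd (prod_decode p))))"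

text \<open>A list is no longer than its code, so \<open>v\<close> steps suffice to read the word with code \<open>v\<close>.\<close>

definition dfa_accepts_code :: "nat \<Rightarrow> nat \<Rightarrow> bool" where
  "dfa_accepts_code c v \<longleftrightarrow>
     nth_code (nth_code c 3)
       (fst (prod_decode ((dfa_step_code c ^^ v) (prod_encode (nth_code c 2, v))))) = 1"

text \<open>Holds for exactly the codes of well-formed automata, as the next lemmas show. Final
  states are stored as a list of bits.\<close>

definition valid_dfa_code :: "nat \<Rightarrow> bool" where
  "valid_dfa_code c \<longleftrightarrow>
     length_code c = 5 \<and> nth_code c 2 < nth_code c 0 \<and>
     length_code (nth_code c 3) = nth_code c 0 \<and>
     (\<forall>q<nth_code c 0. nth_code (nth_code c 3) q < 2) \<and>
     length_code (nth_code c 4) = nth_code c 0 \<and>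
     (\<forall>q<nth_code c 0. length_code (nth_code (nth_code c 4) q) = nth_code c 1 \<and>
        (\<forall>a<nth_code c 1. nth_code (nth_code (nth_code c 4) q) a < nth_code c 0))"

lemma decidable_dfa_accepts_code [computable_intros]:
  assumes "computable n a" "computable n b"
  shows "decidable n (\<lambda>xs. dfa_accepts_code (a xs) (b xs))"
  unfolding dfa_accepts_code_def dfa_step_code_def
  by (intro computable_intros assms computable_funpow1[of "\<lambda>c p.
      if snd (prod_decode p) = 0 then p
      else prod_encode
        (nth_code (nth_code (nth_code c 4) (fst (prod_decode p))) (hd_code (snd (prod_decode p))),
         tl_code (snd (prod_decode p)))"]) simp_all

lemma decidable_valid_dfa_code [computable_intros]:
  assumes "computable n a"
  shows "decidable n (\<lambda>xs. valid_dfa_code (a xs))"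
  unfolding valid_dfa_code_def
  by (intro computable_intros assms decidable_all1[of "\<lambda>q c. nth_code (nth_code c 3) q < 2"]
      decidable_all1[of "\<lambda>q c. length_code (nth_code (nth_code c 4) q) = nth_code c 1 \<and>
        (\<forall>a<nth_code c 1. nth_code (nth_code (nth_code c 4) q) a < nth_code c 0)"]
      decidable_all2[of "\<lambda>a q c. nth_code (nth_code (nth_code c 4) q) a < nth_code c 0"]) simp_all

lemma list_code_cases: obtains xs where "c = list_encode xs"
  by (metis list_decode_inverse)

lemma valid_dfa_code_dfa_code: "wf_dfa A \<Longrightarrow> valid_dfa_code (dfa_code A)"
  by (auto simp: wf_dfa_def valid_dfa_code_def dfa_code_def simp del: list_encode.simps)

lemma valid_dfa_codeE:
  assumes "valid_dfa_code c"
  obtains A where "wf_dfa A" "c = dfa_code A"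
proof -
  obtain xs where c: "c = list_encode xs" by (rule list_code_cases)
  have "length xs = 5" using assms by (simp add: c valid_dfa_code_def)
  then obtain n k s f t where xs: "xs = [n, k, s, f, t]"
    by (auto simp: numeral_eq_Suc length_Suc_conv)
  obtain fs where f: "f = list_encode fs" by (rule list_code_cases)
  obtain ts where t: "t = list_encode ts" by (rule list_code_cases)
  define A where "A = \<lparr>dfa_states = n, dfa_inputs = k, dfa_start = s,
    dfa_final = {q. q < n \<and> fs ! q = 1}, dfa_trans = (\<lambda>q a. nth_code (ts ! q) a)\<rparr>"
  have v: "s < n" "length fs = n" "length ts = n" "\<And>q. q < n \<Longrightarrow> fs ! q < 2"
    "\<And>q. q < n \<Longrightarrow> length_code (ts ! q) = k"
    "\<And>q a. q < n \<Longrightarrow> a < k \<Longrightarrow> nth_code (ts ! q) a < n"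
    using assms by (auto simp: valid_dfa_code_def c xs f t simp del: list_encode.simps)
  \<comment> \<open>Entries below 2 are recovered from the set of positions with entry 1, so
    \<open>c\<close> is literally the code of \<open>A\<close>.\<close>
  have "map (\<lambda>q. of_bool (q \<in> dfa_final A)) [0..<n] = fs"
    using v by (intro nth_equalityI) (auto simp: A_def of_bool_def less_2_cases_iff)
  moreover have "list_encode (map (dfa_trans A q) [0..<k]) = ts ! q" if "q < n" for q
  proof -
    obtain us where us: "ts ! q = list_encode us" by (rule list_code_cases)
    have "map (dfa_trans A q) [0..<k] = us"
      using v(5)[OF that] by (intro nth_equalityI) (auto simp: A_def us)
    then show ?thesis using us by simp
  qed
  then have "map (\<lambda>q. list_encode (map (dfa_trans A q) [0..<k])) [0..<n] = ts"
    using v by (intro nth_equalityI) auto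
  ultimately have "c = dfa_code A"
    by (simp add: dfa_code_def c xs f t A_def del: list_encode.simps)
  moreover have "wf_dfa A" using v by (auto simp: wf_dfa_def A_def)
  ultimately show ?thesis using that by blast
qed

lemma dfa_accepts_code_iff:
  assumes wf: "wf_dfa A" and w: "set w \<subseteq> {..<dfa_inputs A}"
  shows "dfa_accepts_code (dfa_code A) (list_encode w) \<longleftrightarrow> w \<in> dfa_lang A"
proof -
  let ?c = "dfa_code A"
  have c: "nth_code ?c 2 = dfa_start A"
    "nth_code ?c 3 = list_encode (map (\<lambda>q. of_bool (q \<in> dfa_final A)) [0..<dfa_states A])"
    "nth_code ?c 4 = list_encode (map (\<lambda>q. list_encode (map (dfa_trans A q) [0..<dfa_inputs A]))
        [0..<dfa_states A])"
    by (simp_all add: dfa_code_def del: list_encode.simps)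
  have run: "fst (prod_decode ((dfa_step_code ?c ^^ k) (prod_encode (q, list_encode w))))
      = foldl (dfa_trans A) q w"
    if "length w \<le> k" "q < dfa_states A" "set w \<subseteq> {..<dfa_inputs A}" for q k w
    using that
  proof (induction w arbitrary: q k)
    case Nil
    have "dfa_step_code ?c (prod_encode (q, 0)) = prod_encode (q, 0)" for q
      by (simp add: dfa_step_code_def)
    then have "(dfa_step_code ?c ^^ k) (prod_encode (q, 0)) = prod_encode (q, 0)" for q
      by (induction k) simp_all
    then show ?case by simp
  next
    case (Cons a w)
    then obtain k' where k: "k = Suc k'" "length w \<le> k'" by (cases k) auto
    have "dfa_step_code ?c (prod_encode (q, list_encode (a # w)))
        = prod_encode (dfa_trans A q a, list_encode w)"
      using Cons.prems by (simp add: dfa_step_code_def c del: list_encode.simps)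
    moreover have "dfa_trans A q a < dfa_states A" using wf Cons.prems by (simp add: wf_dfa_def)
    ultimately show ?case
      using Cons.IH[OF k(2)] Cons.prems(3) unfolding k(1) funpow_Suc_right comp_apply by simp
  qed
  have "dfa_start A < dfa_states A" using wf by (simp add: wf_dfa_def)
  moreover note foldl_dfa_less[OF wf this w]
  ultimately show ?thesis
    using run[OF length_le_list_encode, of "dfa_start A" w] w
    by (simp add: dfa_accepts_code_def c dfa_lang_def)
qed

text \<open>A tape is represented by the list of the cells to the left of the head, nearest first, and
  the list of the remaining cells; blank cells may be omitted at the ends.\<close>

definition tm_step_code :: "nat \<Rightarrow> nat \<Rightarrow> nat \<Rightarrow> nat \<Rightarrow> nat \<Rightarrow> nat" where
  "tm_step_code m q l r e =
     (if nth_code e 2 = 0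
      then prod_encode (nth_code e 0, prod_encode (tl_code l,
        Suc (prod_encode (if l = 0 then nth_code m 3 else hd_code l,
          Suc (prod_encode (nth_code e 1, tl_code r))))))
      else prod_encode (nth_code e 0, prod_encode (Suc (prod_encode (nth_code e 1, l)), tl_code r)))"

definition tm_next_code :: "nat \<Rightarrow> nat \<Rightarrow> nat \<Rightarrow> nat \<Rightarrow> nat" where
  "tm_next_code m q l r =
     (if q = nth_code m 5 then prod_encode (q, prod_encode (l, r))
      else if q = nth_code m 6 then prod_encode (q, prod_encode (l, r))
      else tm_step_code m q l r
        (nth_code (nth_code (nth_code m 7) q) (if r = 0 then nth_code m 3 else hd_code r)))"

definition tm_config_step_code :: "nat \<Rightarrow> nat \<Rightarrow> nat" where
  "tm_config_step_code m c =
     tm_next_code m (fst (prod_decode c)) (fst (prod_decode (snd (prod_decode c))))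
       (snd (prod_decode (snd (prod_decode c))))"

definition tm_accepts_code :: "nat \<Rightarrow> nat \<Rightarrow> nat \<Rightarrow> bool" where
  "tm_accepts_code m k v \<longleftrightarrow>
     fst (prod_decode ((tm_config_step_code m ^^ k)
       (prod_encode (nth_code m 4, prod_encode (0, v))))) = nth_code m 5"

lemma decidable_tm_accepts_code [computable_intros]:
  assumes "computable n a" "computable n b" "computable n c"
  shows "decidable n (\<lambda>xs. tm_accepts_code (a xs) (b xs) (c xs))"
proof -
  have "computable 2 (\<lambda>ys. tm_config_step_code (ys ! 0) (ys ! 1))"
    unfolding tm_config_step_code_def tm_next_code_def tm_step_code_def
    by (intro computable_intros) simp_all
  then show ?thesis
    unfolding tm_accepts_code_def
    by (intro computable_intros assms computable_funpow1[of tm_config_step_code])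
qed

definition cell :: "nat \<Rightarrow> nat list \<Rightarrow> nat \<Rightarrow> nat" where
  "cell x xs i = (if i < length xs then xs ! i else x)"

lemma cell_simps [simp]:
  "cell x (y # xs) 0 = y" "cell x (y # xs) (Suc i) = cell x xs i" "cell x (tl xs) i = cell x xs (Suc i)"
  by (cases xs; simp add: cell_def)+

definition represents :: "tm \<Rightarrow> nat \<Rightarrow> config \<Rightarrow> bool" where
  "represents M e c \<longleftrightarrow> (\<exists>l r. e = prod_encode (fst c, prod_encode (list_encode l, list_encode r)) \<and>
     (\<forall>i. tape c (pos c + int i) = cell (blank M) r i) \<and>
     (\<forall>i. tape c (pos c - 1 - int i) = cell (blank M) l i))"

lemma representsI:
  assumes "e = prod_encode (q, prod_encode (list_encode l, list_encode r))"
    "\<And>i. t (h + int i) = cell (blank M) r i" "\<And>i. t (h - 1 - int i) = cell (blank M) l i"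
  shows "represents M e (q, t, h)"
  using assms by (auto simp: represents_def)

lemma list_encode_read:
  "(if list_encode r = 0 then x else hd_code (list_encode r)) = cell x r 0"
  by (auto simp: cell_def hd_conv_nth)

lemma tm_code_nth:
  "nth_code (tm_code M) (Suc 0) = num_inputs M" "nth_code (tm_code M) 0 = num_states M"
  "nth_code (tm_code M) 3 = blank M" "nth_code (tm_code M) 4 = start M"
  "nth_code (tm_code M) 5 = acc_state M" "nth_code (tm_code M) 6 = rej_state M"
  "q < num_states M \<Longrightarrow> a < num_syms M \<Longrightarrow> nth_code (nth_code (nth_code (tm_code M) 7) q) a =
     (case trans M q a of (p, b, d) \<Rightarrow> list_encode [p, b, dir_code d])"
  by (simp_all add: tm_code_def del: list_encode.simps)

text \<open>The bounds on state and scanned symbol guarantee that the table contains the entry that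
  is looked up.\<close>

lemma represents_step:
  assumes "represents M e c" "fst c < num_states M" "tape c (pos c) < num_syms M"
  shows "represents M (tm_config_step_code (tm_code M) e) (tm_step M c)"
proof -
  obtain q t h where c: "c = (q, t, h)" using prod_cases3 by blast
  obtain l r where e: "e = prod_encode (q, prod_encode (list_encode l, list_encode r))"
    and r: "\<And>i. t (h + int i) = cell (blank M) r i"
    and l: "\<And>i. t (h - 1 - int i) = cell (blank M) l i"
    using assms(1) by (auto simp: represents_def c)
  show ?thesis
  proof (cases "halting M q")
    case True
    then have "tm_config_step_code (tm_code M) e = e"
      by (auto simp: tm_config_step_code_def tm_next_code_def e tm_code_nth halting_def)
    then show ?thesis using assms(1) True by (simp add: c)
  next
    case False
    obtain p b d where tr: "trans M q (t h) = (p, b, d)" using prod_cases3 by blast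
    have read: "cell (blank M) r 0 = t h" using r[of 0] by simp
    have entry: "nth_code (nth_code (nth_code (tm_code M) 7) q) (t h) = list_encode [p, b, dir_code d]"
      using assms(2,3) tr by (simp add: c tm_code_nth del: list_encode.simps)
    have "tm_config_step_code (tm_code M) e = tm_step_code (tm_code M) q (list_encode l) (list_encode r)
        (nth_code (nth_code (nth_code (tm_code M) 7) q)
          (if list_encode r = 0 then blank M else hd_code (list_encode r)))"
      using False
      by (simp add: tm_config_step_code_def tm_next_code_def e tm_code_nth(3-6) halting_def
          del: list_encode.simps list_encode_eq_0)
    then have step: "tm_config_step_code (tm_code M) e =
        tm_step_code (tm_code M) q (list_encode l) (list_encode r) (list_encode [p, b, dir_code d])"
      unfolding list_encode_read read entry .
    have nth: "nth_code (list_encode [p, b, dir_code d]) 0 = p"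
      "nth_code (list_encode [p, b, dir_code d]) 1 = b"
      "nth_code (list_encode [p, b, dir_code d]) 2 = dir_code d"
      by (simp_all del: list_encode.simps)
    have r': "t (h + 1 + int i) = cell (blank M) r (Suc i)" for i
      using r[of "Suc i"] by (simp add: algebra_simps)
    have l': "t (h - 2 - int i) = cell (blank M) l (Suc i)" for i
      using l[of "Suc i"] by (simp add: algebra_simps)
    show ?thesis
    proof (cases d)
      case L
      have "tm_config_step_code (tm_code M) e = prod_encode (p, prod_encode (list_encode (tl l),
          list_encode (cell (blank M) l 0 # b # tl r)))"
        unfolding step tm_step_code_def nth tm_code_nth list_encode_read
        by (simp add: L dir_code_def)
      moreover have "(t(h := b)) (h - 1 + int i) = cell (blank M) (cell (blank M) l 0 # b # tl r) i" for i
      proof (cases i)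
        case 0
        then show ?thesis using l[of 0] by simp
      next
        case (Suc j)
        then show ?thesis using r[of j] by (cases j) (auto simp: algebra_simps)
      qed
      moreover have "(t(h := b)) (h - 1 - 1 - int i) = cell (blank M) (tl l) i" for i
        using l'[of i] by simp
      ultimately have "represents M (tm_config_step_code (tm_code M) e) (p, t(h := b), h - 1)"
        by (rule representsI)
      then show ?thesis using False tr by (simp add: c L)
    next
      case R
      have "tm_config_step_code (tm_code M) e = prod_encode (p, prod_encode (list_encode (b # l),
          list_encode (tl r)))"
        unfolding step tm_step_code_def nth by (simp add: R dir_code_def)
      moreover have "(t(h := b)) (h + 1 + int i) = cell (blank M) (tl r) i" for i
        using r'[of i] by simp
      moreover have "(t(h := b)) (h + 1 - 1 - int i) = cell (blank M) (b # l) i" for i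
      proof (cases i)
        case (Suc j)
        then show ?thesis using l[of j] by (simp add: algebra_simps)
      qed simp
      ultimately have "represents M (tm_config_step_code (tm_code M) e) (p, t(h := b), h + 1)"
        by (rule representsI)
      then show ?thesis using False tr by (simp add: c R)
    qed
  qed
qed

context linear_time_tm
begin

lemma tm_accepts_code_iff:
  assumes "w \<in> input_words"
  shows "tm_accepts_code (tm_code M) (C * length w + D) (list_encode w) \<longleftrightarrow> w \<in> tm_lang M"
proof -
  let ?e = "prod_encode (start M, prod_encode (0, list_encode w))"
  have "represents M ((tm_config_step_code (tm_code M) ^^ k) ?e) (run M (init_config M w) k)" for k
  proof (induction k)
    case 0
    show ?case
      unfolding represents_def
      by (rule exI[of _ "[]"], rule exI[of _ w]) (auto simp: init_config_def cell_def)
  next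
    case (Suc k)
    then show ?case using represents_step[OF Suc run_wf[OF assms]] by (simp add: run_Suc)
  qed
  from this[of "time_bound w"]
  have "fst (prod_decode ((tm_config_step_code (tm_code M) ^^ time_bound w) ?e)) = final_state w"
    unfolding represents_def final_state_def by fastforce
  then show ?thesis
    using assms by (simp add: tm_accepts_code_def tm_code_nth tm_lang_iff time_bound_def)
qed

end

section \<open>Computable bounds\<close>

text \<open>The code of the list of \<open>n\<close> copies of \<open>k\<close>. By monotonicity of
  pairing it bounds the codes of all words of length at most \<open>n\<close> over letters below
  \<open>k\<close>.\<close>

definition word_code_bound :: "nat \<Rightarrow> nat \<Rightarrow> nat" where
  "word_code_bound k n = ((\<lambda>b. Suc (prod_encode (k, b))) ^^ n) 0"

lemma computable_word_code_bound [computable_intros]: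
  assumes "computable n a" "computable n b"
  shows "computable n (\<lambda>xs. word_code_bound (a xs) (b xs))"
  unfolding word_code_bound_def
  by (intro computable_intros computable_funpow1[of "\<lambda>k b. Suc (prod_encode (k, b))"] assms) simp_all

lemma prod_encode_mono: "a \<le> a' \<Longrightarrow> b \<le> b' \<Longrightarrow> prod_encode (a, b) \<le> prod_encode (a', b')"
  unfolding prod_encode_def triangle_def by (simp add: add_mono div_le_mono mult_le_mono)

lemma list_encode_le_word_code_bound:
  "set w \<subseteq> {..<k} \<Longrightarrow> length w \<le> n \<Longrightarrow> list_encode w \<le> word_code_bound k n"
proof (induction w arbitrary: n)
  case (Cons a w)
  then obtain m where "n = Suc m" "length w \<le> m" by (cases n) auto
  then show ?case using Cons by (auto simp: word_code_bound_def intro!: prod_encode_mono)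
qed simp

text \<open>This and the next two definitions express the earlier bounds by arithmetic in
  \<open>C\<close>, \<open>D\<close> and the number \<open>q\<close> of states.\<close>

definition seq_bound_code :: "nat \<Rightarrow> nat \<Rightarrow> nat" where
  "seq_bound_code q l = (\<Sum>i<Suc l. q ^ i)"

definition visit_bound_code :: "nat \<Rightarrow> nat \<Rightarrow> nat \<Rightarrow> nat" where
  "visit_bound_code C D q = C * (D + 4 * seq_bound_code q (2 * C + 1)) + D"

definition index_bound_code :: "nat \<Rightarrow> nat \<Rightarrow> nat \<Rightarrow> nat" where
  "index_bound_code C D q = Suc (2 ^ (seq_bound_code q (2 * visit_bound_code C D q) * q))"

lemma computable_index_bound_code [computable_intros]:
  assumes "computable n a" "computable n b" "computable n c"
  shows "computable n (\<lambda>xs. index_bound_code (a xs) (b xs) (c xs))"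
  unfolding index_bound_code_def visit_bound_code_def seq_bound_code_def
  by (intro computable_intros assms computable_sum1[of "\<lambda>i q. q ^ i"]) simp_all

section \<open>The test of a candidate\<close>

definition agree_code :: "nat \<Rightarrow> nat \<Rightarrow> nat \<Rightarrow> nat \<Rightarrow> nat \<Rightarrow> bool" where
  "agree_code v c C D m \<longleftrightarrow> (\<forall>i<length_code v. nth_code v i < nth_code m 1) \<longrightarrow>
     (dfa_accepts_code c v \<longleftrightarrow> tm_accepts_code m (C * length_code v + D) v)"

text \<open>The codes \<open>v\<close> below the bound include all words whose length is at most the
  square of the index bound. Longer words may be tested too, which is harmless, and words with
  foreign letters are skipped by \<open>agree_code\<close>.\<close>

definition check_code :: "nat \<Rightarrow> nat \<Rightarrow> nat \<Rightarrow> nat \<Rightarrow> bool" where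
  "check_code c C D m \<longleftrightarrow> valid_dfa_code c \<and> nth_code c 1 = nth_code m 1 \<and>
     nth_code c 0 \<le> index_bound_code C D (nth_code m 0) \<and>
     (\<forall>v<Suc (word_code_bound (nth_code m 1)
          (index_bound_code C D (nth_code m 0) * index_bound_code C D (nth_code m 0))).
        agree_code v c C D m)"

lemma decidable_check_code:
  "decidable 4 (\<lambda>xs. check_code (xs ! 0) (xs ! 1) (xs ! 2) (xs ! 3))"
  unfolding check_code_def agree_code_def
  by (intro computable_intros decidable_all2[of "\<lambda>i v m. nth_code v i < nth_code m 1"]
      decidable_all4[of "\<lambda>v c C D m. (\<forall>i<length_code v. nth_code v i < nth_code m 1) \<longrightarrow>
     (dfa_accepts_code c v \<longleftrightarrow> tm_accepts_code m (C * length_code v + D) v)"]) simp_all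

context linear_time_tm
begin

lemma index_bound_code: "index_bound_code C D (num_states M) = index_bound"
  by (simp add: index_bound_code_def index_bound_def visit_bound_code_def visit_bound_def
      seq_bound_code_def card_short_seqs lessThan_Suc_atMost)

lemma agree_code_iff:
  assumes "wf_dfa A" "dfa_inputs A = num_inputs M"
  shows "agree_code (list_encode w) (dfa_code A) C D (tm_code M) \<longleftrightarrow>
    (w \<in> input_words \<longrightarrow> (w \<in> dfa_lang A \<longleftrightarrow> w \<in> tm_lang M))"
proof -
  have "(\<forall>i<length w. w ! i < num_inputs M) \<longleftrightarrow> w \<in> input_words"
    by (auto simp: input_words_def set_conv_nth)
  then show ?thesis
    using dfa_accepts_code_iff[OF assms(1), of w] assms(2) tm_accepts_code_iff[of w]
    by (auto simp: agree_code_def tm_code_nth input_words_def)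
qed

lemma dfa_code_nth: "nth_code (dfa_code A) 0 = dfa_states A" "nth_code (dfa_code A) (Suc 0) = dfa_inputs A"
  by (simp_all add: dfa_code_def del: list_encode.simps)

lemma ex_small_dfa:
  obtains A where "wf_dfa A" "dfa_inputs A = num_inputs M" "dfa_lang A = tm_lang M"
    "dfa_states A \<le> index_bound"
proof -
  have "tm_lang M \<subseteq> {w. set w \<subseteq> {..<num_inputs M}}" by (auto simp: tm_lang_def)
  from left_quotient_dfa[OF this] card_left_quotients that show ?thesis
    unfolding input_words_def by metis
qed

text \<open>Termination of the search: the automaton of left quotients passes the test.\<close>

lemma ex_check_code: "\<exists>c. check_code c C D (tm_code M)"
proof -
  obtain A where A: "wf_dfa A" "dfa_inputs A = num_inputs M" "dfa_lang A = tm_lang M"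
    "dfa_states A \<le> index_bound"
    by (rule ex_small_dfa)
  have "agree_code v (dfa_code A) C D (tm_code M)" for v
    using agree_code_iff[OF A(1,2), of "list_decode v"] A(3) by simp
  then have "check_code (dfa_code A) C D (tm_code M)"
    using A valid_dfa_code_dfa_code
    by (simp add: check_code_def dfa_code_nth tm_code_nth index_bound_code)
  then show ?thesis by blast
qed

text \<open>Correctness of any result of the search: a candidate is compared with a small automaton
  \<open>B\<close> for the language, which is known only to exist. All words on which the two would
  have to be distinguished are among the tested ones.\<close>

lemma check_codeE:
  assumes "check_code c C D (tm_code M)"
  obtains A where "c = dfa_code A" "wf_dfa A" "dfa_inputs A = num_inputs M" "dfa_lang A = tm_lang M"
proof -
  obtain A where A: "wf_dfa A" "c = dfa_code A"
    using assms by (auto simp: check_code_def elim: valid_dfa_codeE)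
  have inputs: "dfa_inputs A = num_inputs M" and states: "dfa_states A \<le> index_bound"
    and agree: "\<And>v. v \<le> word_code_bound (num_inputs M) (index_bound * index_bound) \<Longrightarrow>
      agree_code v c C D (tm_code M)"
    using assms by (auto simp: check_code_def A dfa_code_nth tm_code_nth index_bound_code less_Suc_eq_le)
  obtain B where B: "wf_dfa B" "dfa_inputs B = num_inputs M" "dfa_lang B = tm_lang M"
    "dfa_states B \<le> index_bound"
    by (rule ex_small_dfa)
  have "dfa_lang A = dfa_lang B"
  proof (rule dfa_lang_eqI[OF A(1) B(1)])
    fix w assume w: "set w \<subseteq> {..<dfa_inputs A}" "length w < dfa_states A * dfa_states B"
    then have "length w \<le> index_bound * index_bound"
      using mult_le_mono[OF states B(4)] by simp
    then have "agree_code (list_encode w) (dfa_code A) C D (tm_code M)"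
      using agree list_encode_le_word_code_bound w inputs A(2) by simp
    then show "w \<in> dfa_lang A \<longleftrightarrow> w \<in> dfa_lang B"
      using agree_code_iff[OF A(1) inputs] w inputs B(3) by (simp add: input_words_def)
  qed (simp add: inputs B)
  then show ?thesis using that A inputs B by simp
qed

end

theorem theorem4p16:
  "\<exists>f :: recf. \<forall>(C :: nat) (D :: nat) (M :: tm).
     wf_tm M \<longrightarrow> runs_in_time M (\<lambda>n. C * n + D) \<longrightarrow>
     (\<exists>A :: dfa. rec_eval f [C, D, tm_code M] = Some (dfa_code A) \<and>
        wf_dfa A \<and> dfa_inputs A = num_inputs M \<and> dfa_lang A = tm_lang M)"
proof -
  \<comment> \<open>Minimization looks for a zero, hence the negated test.\<close>
  obtain r where r: "\<And>xs. length xs = 4 \<Longrightarrow>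
      rec_eval r xs = Some (of_bool (\<not> check_code (xs ! 0) (xs ! 1) (xs ! 2) (xs ! 3)))"
    using decidable_not[OF decidable_check_code] unfolding computable_def by blast
  have "\<exists>A. rec_eval (Mu r) [C, D, tm_code M] = Some (dfa_code A) \<and>
      wf_dfa A \<and> dfa_inputs A = num_inputs M \<and> dfa_lang A = tm_lang M"
    if "wf_tm M" "runs_in_time M (\<lambda>n. C * n + D)" for C D M
  proof -
    interpret linear_time_tm M C D using that by unfold_locales
    let ?c = "LEAST c. check_code c C D (tm_code M)"
    \<comment> \<open>The test is total, so the values below the first zero are defined, as
      \<open>Mu\<close> requires.\<close>
    have "rec_eval r [c, C, D, tm_code M] = Some (of_bool (\<not> check_code c C D (tm_code M)))" for c
      using r[of "[c, C, D, tm_code M]"] by (simp add: numeral_eq_Suc)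
    then have "rec_eval (Mu r) [C, D, tm_code M] = Some ?c"
      using ex_check_code by simp
    moreover have "check_code ?c C D (tm_code M)" using ex_check_code by (rule LeastI_ex)
    ultimately show ?thesis by (elim check_codeE) auto
  qed
  then show ?thesis by blast
qed

end
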